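(* Let $(x^k)_{k\in\mathbb{N}}$ and $(\alpha_k)_{k\in\mathbb{N}}$ be the sequences generated by the FBS method. Suppose that $F=f+g$ is a convex piecewise linear-quadratic function, that the solution set $S^*$ is nonempty, and that $\nabla f$ is locally Lipschitz continuous around any point in $S^*$. Then the sequences $(x^k)_{k\in\mathbb{N}}$ and $(F(x^k))_{k\in\mathbb{N}}$ converge (for any starting point) to some optimal solution and to the optimal value, respectively, with local Q-linear rates. Furthermore, if $\nabla f$ is globally Lipschitz continuous on $\mathrm{int}(\mathrm{dom}\, f)\cap\mathrm{dom}\, g$, then $(x^k)_{k\in\mathbb{N}}$ and $(F(x^k))_{k\in\mathbb{N}}$ converge to some optimal solution and to the optimal value, respectively, with uniform local Q-linear rates that do not depend on the choice of the initial point $x^0$.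
   Context: $\Gamma_0(\mathbb{R}^n)$ is the set of proper, lower semicontinuous, convex functions $\mathbb{R}^n\to\mathbb{R}\cup\{+\infty\}$; $\partial$ is the convex subdifferential. Problem: minimize $F:=f+g$ over $\mathbb{R}^n$; $S^*$ is its set of optimal solutions. Standing assumptions: (A1) $f,g\in\Gamma_0(\mathbb{R}^n)$ and $\mathrm{int}(\mathrm{dom}\, f)\cap \mathrm{dom}\, g\neq\emptyset$. (A2) For any $x\in\mathrm{int}(\mathrm{dom}\, f)\cap\mathrm{dom}\, g$, the sublevel set $\{F\le F(x)\}$ is contained in $\mathrm{int}(\mathrm{dom}\, f)\cap\mathrm{dom}\, g$, and $f$ is continuously differentiable at any point of $\{F\le F(x)\}$. Proximal operator: $\mathrm{prox}_{g}(z):=(\mathrm{Id}+\partial g)^{-1}(z)$. For $x\in\mathrm{int}(\mathrm{dom}\, f)\cap\mathrm{dom}\, g$ and $\alpha>0$ put $J(x,\alpha):=\mathrm{prox}_{\alpha g}(x-\alpha\nabla f(x))$. Line search $LS(x,\sigma,\theta)$ (Beck–Teboulle), for $\sigma>0$, $\theta\in(0,1)$: start with $\alpha=\sigma$; while $f(J(x,\alpha))>f(x)+\langle\nabla f(x),J(x,\alpha)-x\rangle+\frac{1}{2\alpha}\|x-J(x,\alpha)\|^2$, replace $\alpha$ by $\theta\alpha$; output $\alpha$. FBS method: fix $\sigma>0$, $\theta\in(0,1)$, $x^0\in\mathrm{int}(\mathrm{dom}\, f)\cap\mathrm{dom}\, g$, $\alpha_{-1}:=\sigma$, and for $k=0,1,2,\dots$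 set $\alpha_k:=LS(x^k,\alpha_{k-1},\theta)$ and $x^{k+1}:=J(x^k,\alpha_k)$. A function $h\in\Gamma_0(\mathbb{R}^n)$ is convex piecewise linear-quadratic if $\mathrm{dom}\, h$ is a union of finitely many polyhedral sets, relative to each of which $h(x)$ has the form $\frac12\langle x,Ax\rangle+\langle b,x\rangle+c$ for some $c\in\mathbb{R}$, $b\in\mathbb{R}^n$ and symmetric positive semidefinite $A\in\mathbb{R}^{n\times n}$. A sequence $(z^k)$ converges to $z^*$ Q-linearly (locally) with rate $\rho\in(0,1)$ if there is $K\in\mathbb{N}$ with $\|z^{k+1}-z^*\|\le\rho\|z^k-z^*\|$ for all $k\ge K$. The rate is uniform, independent of $x^0$, if the same $\rho\in(0,1)$ works for every admissible $x^0$ (the index $K$ may depend on $x^0$; the data $f,g,\sigma,\theta$ are fixed). *)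

theory Defs
  imports "HOL-Analysis.Analysis" "HOL-Library.While_Combinator"
begin

section \<open>Convex functions with values in the extended reals\<close>

text \<open>Functions into \<open>\<real> \<union> {+\<infinity>}\<close> are functions into \<^typ>\<open>ereal\<close> that never take the value
  \<open>-\<infinity>\<close>; this exclusion is part of properness.\<close>

definition edom :: "('a \<Rightarrow> ereal) \<Rightarrow> 'a set" where
  "edom h = {x. h x < \<infinity>}"

definition proper_fun :: "('a \<Rightarrow> ereal) \<Rightarrow> bool" where
  "proper_fun h \<longleftrightarrow> (\<forall>x. h x \<noteq> -\<infinity>) \<and> edom h \<noteq> {}"

definition lsc_fun :: "('a::topological_space \<Rightarrow> ereal) \<Rightarrow> bool" where
  "lsc_fun h \<longleftrightarrow> (\<forall>x. h x \<le> Liminf (at x) h)"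

text \<open>For a weight \<open>0\<close> the convention \<open>0 * \<infinity> = 0\<close> of \<^typ>\<open>ereal\<close> makes the inequality trivial.\<close>

definition convex_fun :: "('a::real_vector \<Rightarrow> ereal) \<Rightarrow> bool" where
  "convex_fun h \<longleftrightarrow> (\<forall>x y. \<forall>u\<ge>0. \<forall>v\<ge>0. u + v = 1 \<longrightarrow>
     h (u *\<^sub>R x + v *\<^sub>R y) \<le> ereal u * h x + ereal v * h y)"

definition Gamma0 :: "(real^'n \<Rightarrow> ereal) set" where
  "Gamma0 = {h. proper_fun h \<and> lsc_fun h \<and> convex_fun h}"

definition subdiff :: "('a::real_inner \<Rightarrow> ereal) \<Rightarrow> 'a \<Rightarrow> 'a set" where
  "subdiff h x = {v. x \<in> edom h \<and> (\<forall>y. h x + ereal (v \<bullet> (y - x)) \<le> h y)}"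

text \<open>\<open>resolvent h z\<close> is the value at \<open>z\<close> of the set-valued inverse of \<open>Id + \<partial>h\<close>; for \<open>h\<close> in
  \<^const>\<open>Gamma0\<close> it is a singleton, whose element is the proximal point.\<close>

definition resolvent :: "('a::real_inner \<Rightarrow> ereal) \<Rightarrow> 'a \<Rightarrow> 'a set" where
  "resolvent h z = {p. z \<in> (\<lambda>v. p + v) ` subdiff h p}"

definition prox :: "('a::real_inner \<Rightarrow> ereal) \<Rightarrow> 'a \<Rightarrow> 'a" where
  "prox h z = (THE p. p \<in> resolvent h z)"

text \<open>The gradient is taken of the real-valued function \<open>real_of_ereal \<circ> h\<close>. It is meaningful only
  at points of the interior of \<open>edom h\<close> (outside \<open>edom h\<close>, \<^const>\<open>real_of_ereal\<close> returns \<open>0\<close>).\<close>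

definition grad :: "('a::real_inner \<Rightarrow> ereal) \<Rightarrow> 'a \<Rightarrow> 'a" where
  "grad h x = (THE D. GDERIV (\<lambda>y. real_of_ereal (h y)) x :> D)"

definition cont_diff_at :: "('a::real_inner \<Rightarrow> ereal) \<Rightarrow> 'a \<Rightarrow> bool" where
  "cont_diff_at h x \<longleftrightarrow> x \<in> interior (edom h)
     \<and> (\<forall>\<^sub>F y in nhds x. \<exists>D. GDERIV (\<lambda>z. real_of_ereal (h z)) y :> D)
     \<and> isCont (grad h) x"

definition convex_PLQ :: "(real^'n \<Rightarrow> ereal) \<Rightarrow> bool" where
  "convex_PLQ h \<longleftrightarrow> h \<in> Gamma0 \<and>
     (\<exists>P. finite P \<and> edom h = \<Union>P \<and>
       (\<forall>C\<in>P. polyhedron C \<and>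
         (\<exists>A b c. transpose A = A \<and> (\<forall>v. 0 \<le> v \<bullet> (A *v v)) \<and>
           (\<forall>x\<in>C. h x = ereal (1/2 * (x \<bullet> (A *v x)) + b \<bullet> x + c)))))"


section \<open>The composite problem and its standing assumptions\<close>

definition objective :: "('a \<Rightarrow> ereal) \<Rightarrow> ('a \<Rightarrow> ereal) \<Rightarrow> 'a \<Rightarrow> ereal" where
  "objective f g = (\<lambda>x. f x + g x)"

definition solutions :: "('a \<Rightarrow> ereal) \<Rightarrow> ('a \<Rightarrow> ereal) \<Rightarrow> 'a set" where
  "solutions f g = {x. \<forall>y. objective f g x \<le> objective f g y}"

definition optimal_value :: "('a \<Rightarrow> ereal) \<Rightarrow> ('a \<Rightarrow> ereal) \<Rightarrow> ereal" where
  "optimal_value f g = (INF x. objective f g x)"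

definition admissible :: "('a::topological_space \<Rightarrow> ereal) \<Rightarrow> ('a \<Rightarrow> ereal) \<Rightarrow> 'a set" where
  "admissible f g = interior (edom f) \<inter> edom g"

definition assumption_A1 :: "(real^'n \<Rightarrow> ereal) \<Rightarrow> (real^'n \<Rightarrow> ereal) \<Rightarrow> bool" where
  "assumption_A1 f g \<longleftrightarrow> f \<in> Gamma0 \<and> g \<in> Gamma0 \<and> admissible f g \<noteq> {}"

definition assumption_A2 :: "(real^'n \<Rightarrow> ereal) \<Rightarrow> (real^'n \<Rightarrow> ereal) \<Rightarrow> bool" where
  "assumption_A2 f g \<longleftrightarrow> (\<forall>x\<in>admissible f g.
     {y. objective f g y \<le> objective f g x} \<subseteq> admissible f g \<and>
     (\<forall>y\<in>{y. objective f g y \<le> objective f g x}. cont_diff_at f y))"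


section \<open>Forward-backward splitting with the Beck--Teboulle line search\<close>

definition fb_step :: "('a::real_inner \<Rightarrow> ereal) \<Rightarrow> ('a \<Rightarrow> ereal) \<Rightarrow> 'a \<Rightarrow> real \<Rightarrow> 'a" where
  "fb_step f g x \<alpha> = prox (\<lambda>y. ereal \<alpha> * g y) (x - \<alpha> *\<^sub>R grad f x)"

text \<open>\<^const>\<open>while\<close> is unspecified on a loop that does not terminate.\<close>

definition line_search ::
  "('a::real_inner \<Rightarrow> ereal) \<Rightarrow> ('a \<Rightarrow> ereal) \<Rightarrow> 'a \<Rightarrow> real \<Rightarrow> real \<Rightarrow> real" where
  "line_search f g x \<sigma> \<theta> = while
     (\<lambda>\<alpha>. f (fb_step f g x \<alpha>) >
        f x + ereal (grad f x \<bullet> (fb_step f g x \<alpha> - x) + 1 / (2*\<alpha>) * (norm (x - fb_step f g x \<alpha>))\<^sup>2))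
     (\<lambda>\<alpha>. \<theta> * \<alpha>) \<sigma>"

text \<open>The two clauses for \<open>\<alpha>\<close> are \<open>\<alpha>\<^sub>k = LS(x\<^sub>k, \<alpha>\<^sub>k\<^sub>-\<^sub>1, \<theta>)\<close> with \<open>\<alpha>\<^sub>-\<^sub>1 = \<sigma>\<close>.\<close>

definition fbs_sequences ::
  "('a::real_inner \<Rightarrow> ereal) \<Rightarrow> ('a \<Rightarrow> ereal) \<Rightarrow> real \<Rightarrow> real \<Rightarrow> (nat \<Rightarrow> 'a) \<Rightarrow> (nat \<Rightarrow> real) \<Rightarrow> bool" where
  "fbs_sequences f g \<sigma> \<theta> x \<alpha> \<longleftrightarrow>
     x 0 \<in> admissible f g \<and>
     \<alpha> 0 = line_search f g (x 0) \<sigma> \<theta> \<and>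
     (\<forall>k. \<alpha> (Suc k) = line_search f g (x (Suc k)) (\<alpha> k) \<theta>) \<and>
     (\<forall>k. x (Suc k) = fb_step f g (x k) (\<alpha> k))"

definition q_linear :: "(nat \<Rightarrow> 'a::real_normed_vector) \<Rightarrow> 'a \<Rightarrow> real \<Rightarrow> bool" where
  "q_linear z zs \<rho> \<longleftrightarrow> 0 < \<rho> \<and> \<rho> < 1 \<and>
     (\<exists>K. \<forall>k\<ge>K. norm (z (Suc k) - zs) \<le> \<rho> * norm (z k - zs))"

text \<open>Convergence of the objective values is required in \<^typ>\<open>ereal\<close>; together with finiteness of
  the limit this makes the values eventually finite, so that \<^const>\<open>real_of_ereal\<close> in the rate
  loses nothing.\<close>

definition converges_with_rates ::
  "('a::real_inner \<Rightarrow> ereal) \<Rightarrow> ('a \<Rightarrow> ereal) \<Rightarrow> (nat \<Rightarrow> 'a) \<Rightarrow> real \<Rightarrow> real \<Rightarrow> bool" where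
  "converges_with_rates f g x \<rho> \<rho>' \<longleftrightarrow>
     (\<exists>xs\<in>solutions f g. x \<longlonglongrightarrow> xs \<and> q_linear x xs \<rho>) \<and>
     \<bar>optimal_value f g\<bar> \<noteq> \<infinity> \<and>
     (\<lambda>k. objective f g (x k)) \<longlonglongrightarrow> optimal_value f g \<and>
     q_linear (\<lambda>k. real_of_ereal (objective f g (x k))) (real_of_ereal (optimal_value f g)) \<rho>'"

end

theory Submission
  imports Defs
begin

text \<open>The proof rests on two facts: step sizes that stay away from zero, and quadratic growth of the
  objective \<open>F\<close> around the solution set \<open>S\<close>.

  An accepted step from \<open>x\<close> to \<open>p\<close> with step size \<open>\<alpha>\<close> satisfies
  \<open>\<parallel>p - y\<parallel>\<^sup>2 \<le> \<parallel>x - y\<parallel>\<^sup>2 + 2 \<alpha> (F y - F p)\<close> for every \<open>y\<close> (\<open>three_point_inequality\<close>). So values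
  and distances to solutions do not increase. If moreover all step sizes are at least \<open>a > 0\<close> and
  \<open>F x - min F \<ge> c dist(x, S)\<^sup>2\<close> near each solution, then iterates and values converge linearly with rates
  that depend only on the product \<open>a c\<close> (\<open>fejer_growth_rates\<close>).

  The growth constant \<open>c\<close> comes from the piecewise linear-quadratic structure alone. On one polyhedral
  piece it is a compactness argument over the finitely many cones of displacements belonging to sets
  of active constraints (\<open>quadratic_growth_polyhedron\<close>); there are finitely many pieces, so \<open>c\<close> can be
  chosen independently of the solution approached (\<open>PLQ_quadratic_growth\<close>).

  The bound \<open>a\<close> is where the two parts of the statement differ. If \<open>\<nabla>f\<close> is Lipschitz continuous only
  near the solutions, the iterates stay in a compact set on which all sufficiently small steps are
  accepted, because steps tending to zero can be rejected only near a solution, where the local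
  Lipschitz bound excludes it (\<open>sufficient_decrease_compact\<close>). The compact set, and with it \<open>a\<close>,
  depends on the starting point. If \<open>\<nabla>f\<close> is globally Lipschitz continuous with constant \<open>L\<close>, all steps up
  to \<open>1 / (2 L)\<close> are accepted everywhere (\<open>sufficient_decrease_global_Lipschitz\<close>), so neither \<open>a\<close> nor the
  rates depend on the starting point.\<close>

section \<open>Lower semicontinuous convex functions\<close>

abbreviation rval :: "('a \<Rightarrow> ereal) \<Rightarrow> 'a \<Rightarrow> real" where
  "rval h x \<equiv> real_of_ereal (h x)"

text \<open>\<^const>\<open>lsc_fun\<close> uses a punctured limit inferior; at the centre of the neighbourhood the bound holds by
  assumption.\<close>
lemma lsc_fun_open_superlevel:
  assumes "lsc_fun h"
  shows "open {x. t < h x}"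
proof (subst open_subopen, intro ballI)
  fix x assume "x \<in> {x. t < h x}"
  hence "t < h x" by simp
  hence "t < Liminf (at x) h" using assms unfolding lsc_fun_def by (meson less_le_trans)
  hence "\<forall>\<^sub>F y in at x. t < h y" by (rule less_LiminfD)
  then obtain U where "open U" "x \<in> U" "\<forall>y\<in>U. y \<noteq> x \<longrightarrow> t < h y"
    unfolding eventually_at_topological by blast
  with \<open>t < h x\<close> show "\<exists>T. open T \<and> x \<in> T \<and> T \<subseteq> {x. t < h x}"
    by (intro exI[of _ U]) auto
qed

lemma lsc_fun_le_limit:
  fixes h :: "'a::topological_space \<Rightarrow> ereal" and t :: "nat \<Rightarrow> real"
  assumes "lsc_fun h" "X \<longlonglongrightarrow> x" "t \<longlonglongrightarrow> T" "\<And>n. h (X n) \<le> ereal (t n)"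
  shows "h x \<le> ereal T"
proof (rule ccontr)
  assume "\<not> h x \<le> ereal T"
  hence "ereal T < h x" by simp
  then obtain r where r: "ereal T < ereal r" "ereal r < h x" by (metis ereal_dense2)
  have "\<forall>\<^sub>F n in sequentially. X n \<in> {x. ereal r < h x}"
    using lsc_fun_open_superlevel[OF assms(1)] assms(2) r by (intro topological_tendstoD) auto
  moreover have "\<forall>\<^sub>F n in sequentially. t n < r"
    using assms(3) r by (intro order_tendstoD) auto
  ultimately have "\<forall>\<^sub>F n in sequentially. False"
  proof eventually_elim
    case (elim n)
    with assms(4)[of n] have "ereal r < ereal (t n)" by (meson less_le_trans mem_Collect_eq)
    with elim show False by simp
  qed
  thus False by simp
qed

lemma Gamma0_ereal:
  assumes "h \<in> Gamma0" "x \<in> edom h"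
  shows "h x = ereal (rval h x)"
  using assms by (cases "h x") (auto simp: Gamma0_def proper_fun_def edom_def)

lemma edom_if_le:
  assumes "h x \<le> ereal t"
  shows "x \<in> edom h"
  using assms by (auto simp: edom_def intro: le_less_trans)

lemma Gamma0_le_iff:
  assumes "h \<in> Gamma0"
  shows "h x \<le> ereal t \<longleftrightarrow> x \<in> edom h \<and> rval h x \<le> t"
  using Gamma0_ereal[OF assms, of x] edom_if_le[of h x t]
  by (metis ereal_less_eq(3))

lemma infinity_if_not_edom:
  assumes "x \<notin> edom h"
  shows "h x = \<infinity>"
  using assms by (auto simp: edom_def)

lemma Gamma0_convex_on:
  assumes "h \<in> Gamma0"
  shows "convex_on (edom h) (rval h)"
proof -
  have *: "u *\<^sub>R x + v *\<^sub>R y \<in> edom h \<and>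
      rval h (u *\<^sub>R x + v *\<^sub>R y) \<le> u * rval h x + v * rval h y"
    if "x \<in> edom h" "y \<in> edom h" "u \<ge> 0" "v \<ge> 0" "u + v = 1" for x y u v
  proof -
    have "h (u *\<^sub>R x + v *\<^sub>R y) \<le> ereal u * h x + ereal v * h y"
      using assms that unfolding Gamma0_def convex_fun_def by blast
    also have "\<dots> = ereal (u * rval h x + v * rval h y)"
      using that Gamma0_ereal[OF assms] by (metis plus_ereal.simps(1) times_ereal.simps(1))
    finally show ?thesis by (simp add: Gamma0_le_iff[OF assms])
  qed
  show ?thesis
    unfolding convex_on_def convex_def using * by blast
qed

lemma Gamma0_convexD:
  assumes "h \<in> Gamma0" "x \<in> edom h" "y \<in> edom h" "0 \<le> t" "t \<le> 1"
  shows "(1 - t) *\<^sub>R x + t *\<^sub>R y \<in> edom h"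
    and "rval h ((1 - t) *\<^sub>R x + t *\<^sub>R y) \<le> (1 - t) * rval h x + t * rval h y"
  using convex_onD[OF Gamma0_convex_on[OF assms(1)], of t x y]
    convexD_alt[OF convex_on_imp_convex[OF Gamma0_convex_on[OF assms(1)]], of x y t] assms by auto

text \<open>The epigraph of \<open>h\<close> is closed. This is the form in which lower semicontinuity is used below: it
  delivers finiteness at the limit together with the bound.\<close>
lemma Gamma0_lower_limit:
  assumes "h \<in> Gamma0" "X \<longlonglongrightarrow> x" "t \<longlonglongrightarrow> T" "\<And>n. X n \<in> edom h" "\<And>n. rval h (X n) \<le> t n"
  shows "x \<in> edom h \<and> rval h x \<le> T"
  using lsc_fun_le_limit[of h X x t T] assms Gamma0_le_iff[OF assms(1)]
  by (auto simp: Gamma0_def)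

text \<open>The continuous perturbation \<open>q\<close> covers both plain minimization over a compact set and the
  quadratic term of the proximal problem. If there were no minimizer, the open sets on which
  \<open>h + q\<close> exceeds one of its own values would cover \<open>K\<close>; the smallest of the finitely many values
  belonging to a finite subcover would then exceed one of them.\<close>
lemma Gamma0_attains_min:
  assumes h: "h \<in> Gamma0" and K: "compact K" "K \<inter> edom h \<noteq> {}" and q: "continuous_on UNIV q"
  shows "\<exists>p\<in>K \<inter> edom h. \<forall>y\<in>K \<inter> edom h. rval h p + q p \<le> rval h y + q y"
proof (rule ccontr)
  let ?v = "\<lambda>y. rval h y + q y"
  let ?U = "\<lambda>y. {x. ereal (?v y - q x) < h x}"
  assume "\<not> ?thesis"
  hence no_min: "\<exists>y\<in>K \<inter> edom h. ?v y < ?v p" if "p \<in> K \<inter> edom h" for p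
    using that by (metis not_le)
  have U_open: "open (?U y)" for y
  proof -
    have "closed {x. h x \<le> ereal (?v y - q x)}"
      unfolding closed_sequential_limits
    proof (intro allI impI)
      fix X l assume X: "(\<forall>n. X n \<in> {x. h x \<le> ereal (?v y - q x)}) \<and> X \<longlonglongrightarrow> l"
      have "(\<lambda>n. ?v y - q (X n)) \<longlonglongrightarrow> ?v y - q l"
        using continuous_on_tendsto_compose[OF q, of X l] X by (intro tendsto_intros) auto
      thus "l \<in> {x. h x \<le> ereal (?v y - q x)}"
        using lsc_fun_le_limit[of h X l "\<lambda>n. ?v y - q (X n)" "?v y - q l"] h X unfolding Gamma0_def by blast
    qed
    moreover have "?U y = - {x. h x \<le> ereal (?v y - q x)}" by auto
    ultimately show ?thesis by (simp only: open_Compl)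
  qed
  have cover: "K \<subseteq> (\<Union>y\<in>K \<inter> edom h. ?U y)"
  proof
    fix x assume "x \<in> K"
    show "x \<in> (\<Union>y\<in>K \<inter> edom h. ?U y)"
    proof (cases "x \<in> edom h")
      case True
      with no_min \<open>x \<in> K\<close> obtain y where "y \<in> K \<inter> edom h" "?v y < ?v x" by blast
      moreover have "h x = ereal (rval h x)" using Gamma0_ereal[OF h True] .
      ultimately have "x \<in> ?U y" by (metis add.commute diff_less_eq less_ereal.simps(1) mem_Collect_eq)
      thus ?thesis using \<open>y \<in> K \<inter> edom h\<close> by blast
    next
      case False
      thus ?thesis using K(2) infinity_if_not_edom[OF False] by auto
    qed
  qed
  obtain Y where Y: "Y \<subseteq> K \<inter> edom h" "finite Y" "K \<subseteq> (\<Union>y\<in>Y. ?U y)"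
    using compactE_image[OF K(1), of "K \<inter> edom h" ?U] U_open cover by blast
  have "Y \<noteq> {}" using Y K(2) by auto
  define w where "w = arg_min_on ?v Y"
  have w: "w \<in> Y" "\<And>y. y \<in> Y \<Longrightarrow> ?v w \<le> ?v y"
    unfolding w_def using arg_min_if_finite[OF \<open>finite Y\<close> \<open>Y \<noteq> {}\<close>, of ?v]
      arg_min_least[OF \<open>finite Y\<close> \<open>Y \<noteq> {}\<close>, of _ ?v] by auto
  obtain y where y: "y \<in> Y" "w \<in> ?U y" using w(1) Y by blast
  have "h w = ereal (rval h w)" using Gamma0_ereal[OF h] w(1) Y(1) by blast
  with y(2) have "ereal (?v y - q w) < ereal (rval h w)" by (metis mem_Collect_eq)
  with w(2)[OF y(1)] show False by simp
qed

text \<open>This plays the part of an affine minorant. The function \<open>h\<close> has a minimum on a unit ball around a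
  point \<open>z\<close> of its domain, and if \<open>h\<close> fell below \<open>h z\<close> faster along a ray than by the drop \<open>b\<close> per unit
  length, convexity would force too small a value where the ray leaves the ball.\<close>
lemma Gamma0_norm_minorant:
  fixes h :: "real^'n \<Rightarrow> ereal"
  assumes h: "h \<in> Gamma0"
  shows "\<exists>a b. 0 \<le> b \<and> (\<forall>y\<in>edom h. a - b * norm y \<le> rval h y)"
proof -
  obtain z where z: "z \<in> edom h" using h by (auto simp: Gamma0_def proper_fun_def)
  obtain p where p: "p \<in> cball z 1 \<inter> edom h" "\<And>y. y \<in> cball z 1 \<inter> edom h \<Longrightarrow> rval h p \<le> rval h y"
  proof -
    have ne: "cball z 1 \<inter> edom h \<noteq> {}" using z by (metis Int_iff centre_in_cball empty_iff zero_le_one)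
    have "\<exists>p\<in>cball z 1 \<inter> edom h. \<forall>y\<in>cball z 1 \<inter> edom h. rval h p + 0 \<le> rval h y + 0"
      by (rule Gamma0_attains_min[OF h compact_cball ne]) simp
    thus ?thesis using that by auto
  qed
  define b where "b = rval h z - rval h p"
  have b: "0 \<le> b" unfolding b_def using p(2)[of z] z by simp
  have "rval h z - b * (1 + norm (y - z)) \<le> rval h y" if y: "y \<in> edom h" for y
  proof (cases "norm (y - z) \<le> 1")
    case True
    hence "rval h p \<le> rval h y" using p(2)[of y] y by (simp add: dist_norm norm_minus_commute)
    moreover have "0 \<le> b * norm (y - z)" using b by simp
    ultimately show ?thesis unfolding b_def by (simp add: algebra_simps)
  next
    case False
    define r where "r = norm (y - z)"
    have r: "r > 1" using False r_def by simp
    \<comment> \<open>The point where the segment from \<open>z\<close> to \<open>y\<close> leaves the unit ball.\<close>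
    let ?w = "(1 - 1/r) *\<^sub>R z + (1/r) *\<^sub>R y"
    have w: "?w \<in> edom h" "rval h ?w \<le> (1 - 1/r) * rval h z + (1/r) * rval h y"
      using Gamma0_convexD[OF h z y, of "1/r"] r by auto
    have "?w - z = (1/r) *\<^sub>R (y - z)" by (simp add: algebra_simps)
    hence "norm (?w - z) = \<bar>1/r\<bar> * r" by (simp only: norm_scaleR r_def)
    hence "norm (?w - z) = 1" using r by simp
    hence "rval h p \<le> rval h ?w" using p(2)[of ?w] w by (simp add: dist_norm norm_minus_commute)
    with w have "rval h p \<le> (1 - 1/r) * rval h z + (1/r) * rval h y" by linarith
    hence "r * rval h p \<le> r * ((1 - 1/r) * rval h z + (1/r) * rval h y)"
      using r by (intro mult_left_mono) auto
    also have "\<dots> = (r - 1) * rval h z + rval h y" using r by (simp add: field_simps)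
    finally show ?thesis using b unfolding r_def[symmetric] b_def by (simp add: algebra_simps)
  qed
  moreover have "b * (1 + norm (y - z)) \<le> b * (1 + norm z) + b * norm y" for y
  proof -
    have "b * (1 + norm (y - z)) \<le> b * (1 + (norm z + norm y))"
      using b norm_triangle_ineq4[of y z] by (intro mult_left_mono) auto
    thus ?thesis by (simp add: algebra_simps)
  qed
  ultimately have "\<forall>y\<in>edom h. (rval h z - b * (1 + norm z)) - b * norm y \<le> rval h y"
    by (smt (verit, best))
  thus ?thesis using b by blast
qed

section \<open>The forward-backward step\<close>

lemma quadratic_dominates_linear:
  fixes a b c v r :: real
  assumes "c > 0" "b \<ge> 0" "r \<ge> (b + \<bar>v - a\<bar>) / c + 1"
  shows "v \<le> a - b * r + c * r\<^sup>2"
proof -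
  have "r \<ge> 1" using assms by (smt (verit) divide_nonneg_pos)
  have "c * (r - 1) \<ge> b + \<bar>v - a\<bar>" using assms by (simp add: field_simps)
  hence "c * r - b \<ge> \<bar>v - a\<bar>" using assms by (simp add: algebra_simps)
  hence "r * (c * r - b) \<ge> 1 * \<bar>v - a\<bar>" using \<open>r \<ge> 1\<close> by (intro mult_mono) auto
  thus ?thesis by (simp add: algebra_simps power2_eq_square)
qed

text \<open>The norm minorant makes the quadratic term dominate outside a large ball, so minimizing over that
  ball is enough.\<close>
lemma Gamma0_prox_minimizer:
  fixes g :: "real^'n \<Rightarrow> ereal"
  assumes g: "g \<in> Gamma0" and c: "c > 0"
  shows "\<exists>p\<in>edom g. \<forall>y\<in>edom g. rval g p + c * (norm (p - z))\<^sup>2 \<le> rval g y + c * (norm (y - z))\<^sup>2"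
proof -
  obtain a b where ab: "0 \<le> b" "\<And>y. y \<in> edom g \<Longrightarrow> a - b * norm y \<le> rval g y"
    using Gamma0_norm_minorant[OF g] by blast
  obtain w where w: "w \<in> edom g" using g by (auto simp: Gamma0_def proper_fun_def)
  define a' where "a' = a - b * norm z"
  have minor: "a' - b * norm (y - z) \<le> rval g y" if "y \<in> edom g" for y
  proof -
    have "b * norm y \<le> b * (norm z + norm (y - z))"
      using ab(1) norm_triangle_sub[of y z] by (intro mult_left_mono) auto
    thus ?thesis using ab(2)[OF that] unfolding a'_def by (simp add: algebra_simps)
  qed
  define v where "v = rval g w + c * (norm (w - z))\<^sup>2"
  define R where "R = max (norm (w - z)) ((b + \<bar>v - a'\<bar>) / c + 1)"
  have "continuous_on UNIV (\<lambda>y. c * (norm (y - z))\<^sup>2)" by (intro continuous_intros)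
  moreover have wR: "w \<in> cball z R \<inter> edom g" using w by (simp add: R_def dist_norm norm_minus_commute)
  ultimately obtain p where p: "p \<in> cball z R \<inter> edom g"
    "\<And>y. y \<in> cball z R \<inter> edom g \<Longrightarrow> rval g p + c * (norm (p - z))\<^sup>2 \<le> rval g y + c * (norm (y - z))\<^sup>2"
    using Gamma0_attains_min[OF g compact_cball[of z R], of "\<lambda>y. c * (norm (y - z))\<^sup>2"] by blast
  have "rval g p + c * (norm (p - z))\<^sup>2 \<le> rval g y + c * (norm (y - z))\<^sup>2" if y: "y \<in> edom g" for y
  proof (cases "norm (y - z) \<le> R")
    case True
    thus ?thesis using p(2)[of y] y by (simp add: dist_norm norm_minus_commute)
  next
    case False
    hence "v \<le> a' - b * norm (y - z) + c * (norm (y - z))\<^sup>2"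
      using c ab(1) by (intro quadratic_dominates_linear) (auto simp: R_def)
    with minor[OF y] p(2)[OF wR] show ?thesis unfolding v_def by linarith
  qed
  thus ?thesis using p(1) by blast
qed

text \<open>Passing to the limit \<open>t \<rightarrow> 0\<close> in an inequality that was divided by \<open>t\<close>; each first-order condition
  obtained below by moving along a segment ends this way.\<close>
lemma le_of_forall_small_slack:
  fixes a b c :: real
  assumes "\<And>t. 0 < t \<Longrightarrow> t < 1 \<Longrightarrow> a \<le> b + t * c"
  shows "a \<le> b"
proof (rule tendsto_lowerbound)
  have "((\<lambda>t. b + t * c) \<longlongrightarrow> b + 0 * c) (at_right 0)" by (intro tendsto_intros)
  thus "((\<lambda>t. b + t * c) \<longlongrightarrow> b) (at_right 0)" by simp
  show "\<forall>\<^sub>F t in at_right 0. a \<le> b + t * c"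
    unfolding eventually_at_right_field using assms by (intro exI[of _ 1]) auto
qed simp

text \<open>Compare the minimizer \<open>p\<close> with the point at fraction \<open>t\<close> of the segment from \<open>p\<close> to \<open>y\<close>: after
  division by \<open>t\<close> the quadratic term contributes \<open>(p - z) \<bullet> (y - p)\<close> up to an error of order \<open>t\<close>.\<close>
lemma prox_minimizer_variational:
  fixes g :: "real^'n \<Rightarrow> ereal"
  assumes g: "g \<in> Gamma0" and \<alpha>: "\<alpha> > 0" and p: "p \<in> edom g"
    and min: "\<And>y. y \<in> edom g \<Longrightarrow>
        rval g p + 1/(2*\<alpha>) * (norm (p - z))\<^sup>2 \<le> rval g y + 1/(2*\<alpha>) * (norm (y - z))\<^sup>2"
    and y: "y \<in> edom g"
  shows "\<alpha> * rval g p + (z - p) \<bullet> (y - p) \<le> \<alpha> * rval g y"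
proof (rule le_of_forall_small_slack)
  fix t :: real assume t: "0 < t" "t < 1"
  let ?w = "(1 - t) *\<^sub>R p + t *\<^sub>R y"
  have w: "?w \<in> edom g" "rval g ?w \<le> (1 - t) * rval g p + t * rval g y"
    using Gamma0_convexD[OF g p y] t by auto
  have e: "?w - z = (p - z) + t *\<^sub>R (y - p)" by (simp add: algebra_simps)
  have sq: "(norm (?w - z))\<^sup>2 = (norm (p - z))\<^sup>2 + t * (2 * ((p - z) \<bullet> (y - p)) + t * (norm (y - p))\<^sup>2)"
    unfolding e power2_norm_eq_inner
    by (simp add: inner_add_left inner_add_right inner_commute power2_eq_square algebra_simps)
  have "2 * \<alpha> * (rval g p + 1/(2*\<alpha>) * (norm (p - z))\<^sup>2) \<le> 2 * \<alpha> * (rval g ?w + 1/(2*\<alpha>) * (norm (?w - z))\<^sup>2)"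
    using min[OF w(1)] \<alpha> by (intro mult_left_mono) auto
  hence "2 * \<alpha> * rval g p + (norm (p - z))\<^sup>2 \<le> 2 * \<alpha> * rval g ?w + (norm (?w - z))\<^sup>2"
    using \<alpha> by (simp add: algebra_simps)
  moreover have "2 * \<alpha> * rval g ?w \<le> 2 * \<alpha> * ((1 - t) * rval g p + t * rval g y)"
    using w(2) \<alpha> by (intro mult_left_mono) auto
  ultimately have "t * (2 * \<alpha> * rval g p) \<le> t * (2 * \<alpha> * rval g y + 2 * ((p - z) \<bullet> (y - p)) + t * (norm (y - p))\<^sup>2)"
    unfolding sq by (simp add: algebra_simps)
  hence "2 * \<alpha> * rval g p \<le> 2 * \<alpha> * rval g y + 2 * ((p - z) \<bullet> (y - p)) + t * (norm (y - p))\<^sup>2"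
    using t by simp
  moreover have "(p - z) \<bullet> (y - p) = - ((z - p) \<bullet> (y - p))" by (simp add: inner_diff_left)
  ultimately show "\<alpha> * rval g p + (z - p) \<bullet> (y - p) \<le> \<alpha> * rval g y + t * ((norm (y - p))\<^sup>2 / 2)"
    by simp
qed

lemma mem_resolvent_scaled_iff:
  fixes g :: "real^'n \<Rightarrow> ereal"
  assumes g: "g \<in> Gamma0" and \<alpha>: "\<alpha> > 0"
  shows "p \<in> resolvent (\<lambda>y. ereal \<alpha> * g y) z \<longleftrightarrow>
     p \<in> edom g \<and> (\<forall>y\<in>edom g. \<alpha> * rval g p + (z - p) \<bullet> (y - p) \<le> \<alpha> * rval g y)"
proof -
  let ?h = "\<lambda>y. ereal \<alpha> * g y"
  have dom: "edom ?h = edom g" and val: "\<And>y. y \<in> edom g \<Longrightarrow> ?h y = ereal (\<alpha> * rval g y)"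
    and inf: "\<And>y. y \<notin> edom g \<Longrightarrow> ?h y = \<infinity>"
  proof -
    show v: "?h y = ereal (\<alpha> * rval g y)" if "y \<in> edom g" for y
      using Gamma0_ereal[OF g that] by (metis times_ereal.simps(1))
    show i: "?h y = \<infinity>" if "y \<notin> edom g" for y
      using infinity_if_not_edom[OF that] \<alpha> by simp
    show "edom ?h = edom g"
    proof (rule set_eqI)
      fix y
      have "y \<in> edom ?h \<longleftrightarrow> ?h y < \<infinity>" by (simp add: edom_def)
      also have "\<dots> \<longleftrightarrow> y \<in> edom g"
        using v[of y] i[of y] by (cases "y \<in> edom g") simp_all
      finally show "y \<in> edom ?h \<longleftrightarrow> y \<in> edom g" .
    qed
  qed
  have "p \<in> resolvent ?h z \<longleftrightarrow> z - p \<in> subdiff ?h p"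
  proof
    assume "p \<in> resolvent ?h z"
    then obtain v where "z = p + v" "v \<in> subdiff ?h p" unfolding resolvent_def by blast
    thus "z - p \<in> subdiff ?h p" by simp
  next
    assume "z - p \<in> subdiff ?h p"
    moreover have "z = p + (z - p)" by simp
    ultimately show "p \<in> resolvent ?h z" unfolding resolvent_def by blast
  qed
  also have "\<dots> \<longleftrightarrow> p \<in> edom g \<and> (\<forall>y. ?h p + ereal ((z - p) \<bullet> (y - p)) \<le> ?h y)"
    unfolding subdiff_def dom by simp
  also have "\<dots> \<longleftrightarrow> p \<in> edom g \<and> (\<forall>y\<in>edom g. \<alpha> * rval g p + (z - p) \<bullet> (y - p) \<le> \<alpha> * rval g y)"
    using val inf by (metis ereal_less_eq(1) ereal_less_eq(3) plus_ereal.simps(1))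
  finally show ?thesis .
qed

text \<open>This makes the definite description in \<^const>\<open>prox\<close> meaningful: existence is the minimization above,
  uniqueness is monotonicity of the subdifferential.\<close>
lemma prox_scaled:
  fixes g :: "real^'n \<Rightarrow> ereal"
  assumes g: "g \<in> Gamma0" and \<alpha>: "\<alpha> > 0"
  shows "prox (\<lambda>y. ereal \<alpha> * g y) z \<in> resolvent (\<lambda>y. ereal \<alpha> * g y) z"
  unfolding prox_def
proof (rule theI')
  let ?R = "resolvent (\<lambda>y. ereal \<alpha> * g y) z"
  note R = mem_resolvent_scaled_iff[OF g \<alpha>, of _ z]
  show "\<exists>!p. p \<in> ?R"
  proof (rule ex_ex1I)
    have "1/(2*\<alpha>) > 0" using \<alpha> by simp
    from Gamma0_prox_minimizer[OF g this, of z] show "\<exists>p. p \<in> ?R"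
      using prox_minimizer_variational[OF g \<alpha>] R by metis
  next
    fix p q assume "p \<in> ?R" "q \<in> ?R"
    hence "\<alpha> * rval g p + (z - p) \<bullet> (q - p) \<le> \<alpha> * rval g q" "\<alpha> * rval g q + (z - q) \<bullet> (p - q) \<le> \<alpha> * rval g p"
      using R by auto
    hence "(z - p) \<bullet> (q - p) + (z - q) \<bullet> (p - q) \<le> 0" by linarith
    moreover have "(z - p) \<bullet> (q - p) + (z - q) \<bullet> (p - q) = (p - q) \<bullet> (p - q)"
      by (simp add: inner_diff_left inner_diff_right inner_commute)
    ultimately have "(p - q) \<bullet> (p - q) \<le> 0" by simp
    thus "p = q" by (metis inner_gt_zero_iff not_le right_minus_eq)
  qed
qed

text \<open>The vector \<open>(x - p) / \<alpha> - \<nabla>f(x)\<close> is a subgradient of \<open>g\<close> at the new point \<open>p\<close>. All later estimates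
  see the proximal step only through this inequality.\<close>
lemma fb_step_variational:
  fixes f g :: "real^'n \<Rightarrow> ereal" and x :: "real^'n"
  assumes g: "g \<in> Gamma0" and \<alpha>: "\<alpha> > 0"
  defines "p \<equiv> fb_step f g x \<alpha>"
  shows "p \<in> edom g"
    and "y \<in> edom g \<Longrightarrow> rval g p + ((x - p) /\<^sub>R \<alpha> - grad f x) \<bullet> (y - p) \<le> rval g y"
proof -
  have *: "p \<in> edom g \<and> (\<forall>y\<in>edom g. \<alpha> * rval g p + (x - \<alpha> *\<^sub>R grad f x - p) \<bullet> (y - p) \<le> \<alpha> * rval g y)"
    using prox_scaled[OF g \<alpha>, of "x - \<alpha> *\<^sub>R grad f x"] mem_resolvent_scaled_iff[OF g \<alpha>]
    unfolding p_def fb_step_def by metis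
  show "p \<in> edom g" using * by simp
  assume y: "y \<in> edom g"
  have "\<alpha> * (rval g p + ((x - p) /\<^sub>R \<alpha> - grad f x) \<bullet> (y - p)) = \<alpha> * rval g p + (x - \<alpha> *\<^sub>R grad f x - p) \<bullet> (y - p)"
    using \<alpha> by (simp add: inner_diff_left distrib_left right_diff_distrib flip: mult.assoc)
  also have "\<dots> \<le> \<alpha> * rval g y" using * y by blast
  finally show "rval g p + ((x - p) /\<^sub>R \<alpha> - grad f x) \<bullet> (y - p) \<le> rval g y"
    using \<alpha> by simp
qed

section \<open>Gradients of convex functions\<close>

lemma GDERIV_grad:
  assumes "GDERIV (rval h) x :> D"
  shows "grad h x = D"
  unfolding grad_def
proof (rule the_equality)
  show "GDERIV (rval h) x :> D" by (rule assms)
next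
  fix E assume "GDERIV (rval h) x :> E"
  hence "(\<lambda>v. v \<bullet> E) = (\<lambda>v. v \<bullet> D)"
    using assms has_derivative_unique unfolding gderiv_def by blast
  hence "(E - D) \<bullet> E = (E - D) \<bullet> D" by metis
  hence "(E - D) \<bullet> (E - D) = 0" by (simp add: inner_diff_right)
  thus "E = D" by simp
qed

text \<open>The difference quotient of a convex function along the segment to \<open>y\<close> is at most \<open>h y - h x\<close>, and it
  tends to the directional derivative.\<close>
lemma grad_inequality:
  fixes h :: "real^'n \<Rightarrow> ereal"
  assumes h: "h \<in> Gamma0" and d: "GDERIV (rval h) x :> D" and x: "x \<in> edom h" and y: "y \<in> edom h"
  shows "rval h x + grad h x \<bullet> (y - x) \<le> rval h y"
proof -
  have "(rval h has_derivative (\<lambda>v. v \<bullet> D)) (at (x + 0 *\<^sub>R (y - x)))"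
    using d unfolding gderiv_def by simp
  hence "((\<lambda>t. rval h (x + t *\<^sub>R (y - x))) has_derivative (\<lambda>t. (t *\<^sub>R (y - x)) \<bullet> D)) (at 0)"
    by (rule has_derivative_compose[rotated]) (auto intro!: derivative_eq_intros)
  hence "((\<lambda>t. rval h (x + t *\<^sub>R (y - x))) has_real_derivative ((y - x) \<bullet> D)) (at 0)"
    by (simp add: has_field_derivative_def mult_commute_abs)
  hence lim: "((\<lambda>t. (rval h (x + t *\<^sub>R (y - x)) - rval h x) / t) \<longlongrightarrow> (y - x) \<bullet> D) (at_right 0)"
    unfolding DERIV_def by (auto intro: tendsto_within_subset)
  have "(y - x) \<bullet> D \<le> rval h y - rval h x"
  proof (rule tendsto_upperbound[OF lim])
    have "(rval h (x + t *\<^sub>R (y - x)) - rval h x) / t \<le> rval h y - rval h x" if t: "0 < t" "t < 1" for t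
    proof -
      have "rval h ((1 - t) *\<^sub>R x + t *\<^sub>R y) \<le> (1 - t) * rval h x + t * rval h y"
        using Gamma0_convexD(2)[OF h x y] t by auto
      moreover have "(1 - t) *\<^sub>R x + t *\<^sub>R y = x + t *\<^sub>R (y - x)" by (simp add: algebra_simps)
      ultimately show ?thesis using t by (simp add: field_simps)
    qed
    thus "\<forall>\<^sub>F t in at_right 0. (rval h (x + t *\<^sub>R (y - x)) - rval h x) / t \<le> rval h y - rval h x"
      unfolding eventually_at_right_field by (intro exI[of _ 1]) auto
  qed simp
  thus ?thesis using GDERIV_grad[OF d] by (simp add: inner_commute)
qed

lemma cont_diff_atD:
  assumes "cont_diff_at h x"
  shows "x \<in> interior (edom h)" "isCont (grad h) x"
    "\<exists>r>0. \<forall>y\<in>ball x r. y \<in> interior (edom h) \<and> GDERIV (rval h) y :> grad h y"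
proof -
  show x: "x \<in> interior (edom h)" and "isCont (grad h) x"
    using assms unfolding cont_diff_at_def by auto
  have "\<forall>\<^sub>F y in nhds x. y \<in> interior (edom h)"
    using x by (intro eventually_nhds_in_open) auto
  moreover have "\<forall>\<^sub>F y in nhds x. \<exists>D. GDERIV (rval h) y :> D"
    using assms unfolding cont_diff_at_def by auto
  ultimately have "\<forall>\<^sub>F y in nhds x. y \<in> interior (edom h) \<and> GDERIV (rval h) y :> grad h y"
    by eventually_elim (metis GDERIV_grad)
  thus "\<exists>r>0. \<forall>y\<in>ball x r. y \<in> interior (edom h) \<and> GDERIV (rval h) y :> grad h y"
    by (simp add: eventually_nhds_metric Ball_def dist_commute)
qed

lemma cont_diff_at_grad_inequality:
  fixes h :: "real^'n \<Rightarrow> ereal"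
  assumes h: "h \<in> Gamma0" and "cont_diff_at h x" and y: "y \<in> edom h"
  shows "rval h x + grad h x \<bullet> (y - x) \<le> rval h y"
proof -
  have "x \<in> edom h" using cont_diff_atD(1)[OF assms(2)] interior_subset by blast
  moreover obtain r where "r > 0" "\<forall>y\<in>ball x r. GDERIV (rval h) y :> grad h y"
    using cont_diff_atD(3)[OF assms(2)] by blast
  hence "GDERIV (rval h) x :> grad h x" by simp
  ultimately show ?thesis using grad_inequality[OF h _ _ y] by blast
qed

text \<open>The gradient inequality at \<open>y\<close> instead of \<open>x\<close>. Only gradients at the two end points enter. Compared with
  the descent lemma for an \<open>L\<close>-Lipschitz gradient this costs a factor \<open>2\<close>, which is why the thresholds
  for accepted steps below are \<open>1 / (2 L)\<close>.\<close>
lemma linearization_error_le: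
  fixes h :: "real^'n \<Rightarrow> ereal"
  assumes h: "h \<in> Gamma0" and y: "y \<in> edom h" "GDERIV (rval h) y :> grad h y" and x: "x \<in> edom h"
  shows "rval h y \<le> rval h x + grad h x \<bullet> (y - x) + norm (grad h y - grad h x) * norm (y - x)"
proof -
  have "rval h y + grad h y \<bullet> (x - y) \<le> rval h x" using grad_inequality[OF h y(2,1) x] .
  moreover have "(grad h y - grad h x) \<bullet> (y - x) \<le> norm (grad h y - grad h x) * norm (y - x)"
    by (rule norm_cauchy_schwarz)
  moreover have "(grad h y - grad h x) \<bullet> (y - x) = - (grad h y \<bullet> (x - y)) - grad h x \<bullet> (y - x)"
    by (simp add: inner_diff_left inner_diff_right)
  ultimately show ?thesis by linarith
qed

section \<open>The backtracking loop\<close>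

definition sufficient_decrease :: "(real^'n \<Rightarrow> ereal) \<Rightarrow> (real^'n \<Rightarrow> ereal) \<Rightarrow> real^'n \<Rightarrow> real \<Rightarrow> bool" where
  "sufficient_decrease f g x \<alpha> \<longleftrightarrow> f (fb_step f g x \<alpha>) \<le>
     f x + ereal (grad f x \<bullet> (fb_step f g x \<alpha> - x) + 1 / (2*\<alpha>) * (norm (x - fb_step f g x \<alpha>))\<^sup>2)"

lemma line_search_while:
  "line_search f g x \<sigma> \<theta> = while (\<lambda>\<alpha>. \<not> sufficient_decrease f g x \<alpha>) (\<lambda>\<alpha>. \<theta> * \<alpha>) \<sigma>"
  unfolding line_search_def sufficient_decrease_def by (simp only: not_le)

text \<open>If every \<open>\<alpha> \<le> c\<close> is accepted, the loop terminates; and a rejected value exceeds \<open>c\<close>, so the value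
  tried after it still exceeds \<open>\<theta> * c\<close>.\<close>
lemma backtracking_while:
  fixes \<theta> \<sigma> c :: real
  assumes \<theta>: "0 < \<theta>" "\<theta> < 1" and c: "c > 0" and \<sigma>: "\<sigma> > 0"
    and acc: "\<And>\<alpha>. 0 < \<alpha> \<Longrightarrow> \<alpha> \<le> c \<Longrightarrow> P \<alpha>"
  defines "w \<equiv> while (\<lambda>\<alpha>. \<not> P \<alpha>) (\<lambda>\<alpha>. \<theta> * \<alpha>) \<sigma>"
  shows "P w \<and> min \<sigma> (\<theta> * c) \<le> w"
proof -
  let ?w = "while (\<lambda>\<alpha>. \<not> P \<alpha>) (\<lambda>\<alpha>. \<theta> * \<alpha>)"
  have "s > 0 \<Longrightarrow> \<theta> ^ n * s \<le> c \<Longrightarrow> P (?w s) \<and> min s (\<theta> * c) \<le> ?w s" for n s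
  proof (induction n arbitrary: s)
    case 0
    hence "P s" using acc by simp
    hence "?w s = s" by (subst while_unfold) simp
    thus ?case using \<open>P s\<close> by simp
  next
    case (Suc n)
    show ?case
    proof (cases "P s")
      case True
      hence "?w s = s" by (subst while_unfold) simp
      thus ?thesis using True by simp
    next
      case False
      hence unfold: "?w s = ?w (\<theta> * s)" by (subst while_unfold) simp
      have "c < s" using False acc Suc.prems(1) by (meson not_le)
      hence "\<theta> * c \<le> \<theta> * s" using \<theta> by simp
      moreover have "P (?w (\<theta> * s)) \<and> min (\<theta> * s) (\<theta> * c) \<le> ?w (\<theta> * s)"
        using Suc.prems \<theta> by (intro Suc.IH) (auto simp: mult_ac)
      ultimately show ?thesis unfolding unfold by (auto simp: min_def split: if_splits)
    qed
  qed
  moreover have "\<exists>n. \<theta> ^ n * \<sigma> \<le> c"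
  proof -
    obtain n where "\<theta> ^ n < c / \<sigma>" using real_arch_pow_inv[of "c/\<sigma>" \<theta>] \<theta> c \<sigma> by auto
    thus ?thesis using \<sigma> by (intro exI[of _ n]) (simp add: field_simps)
  qed
  ultimately show ?thesis unfolding w_def using \<sigma> by blast
qed

lemma line_search_bounds:
  fixes f g :: "real^'n \<Rightarrow> ereal"
  assumes "0 < \<theta>" "\<theta> < 1" "c > 0" "\<sigma> > 0"
    and "\<And>\<alpha>. 0 < \<alpha> \<Longrightarrow> \<alpha> \<le> c \<Longrightarrow> sufficient_decrease f g x \<alpha>"
  shows "sufficient_decrease f g x (line_search f g x \<sigma> \<theta>)"
    "min \<sigma> (\<theta> * c) \<le> line_search f g x \<sigma> \<theta>"
  using backtracking_while[OF assms(1-4), of "sufficient_decrease f g x"] assms(5)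
  unfolding line_search_while by auto

section \<open>Decrease along accepted steps\<close>

lemma edom_objective:
  assumes "f \<in> Gamma0" "g \<in> Gamma0"
  shows "edom (objective f g) = edom f \<inter> edom g"
    and "x \<in> edom f \<inter> edom g \<Longrightarrow> rval (objective f g) x = rval f x + rval g x"
proof -
  have *: "objective f g x = ereal (rval f x + rval g x)" if "x \<in> edom f \<inter> edom g" for x
    using that Gamma0_ereal[OF assms(1), of x] Gamma0_ereal[OF assms(2), of x]
    unfolding objective_def by (metis Int_iff plus_ereal.simps(1))
  thus "x \<in> edom f \<inter> edom g \<Longrightarrow> rval (objective f g) x = rval f x + rval g x" by simp
  have "x \<notin> edom (objective f g)" if "x \<notin> edom f \<inter> edom g" for x
    using that by (auto simp: edom_def objective_def)
  thus "edom (objective f g) = edom f \<inter> edom g"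
    using * by (auto simp: edom_def[of "objective f g"])
qed

text \<open>This is all that the rates use about a single step: with \<open>y = x\<close> it says
  that values do not increase, with \<open>y\<close> a solution that the distance to it does not increase, and with
  intermediate \<open>y\<close> it yields the rate of the values. It is the sum of the stopping test, the gradient
  inequality of \<open>f\<close> and the subgradient inequality of \<open>g\<close>.\<close>
lemma three_point_inequality:
  fixes f g :: "real^'n \<Rightarrow> ereal" and x y :: "real^'n"
  assumes f: "f \<in> Gamma0" and g: "g \<in> Gamma0" and \<alpha>: "\<alpha> > 0"
    and cd: "cont_diff_at f x"
    and dec: "sufficient_decrease f g x \<alpha>"
  defines "p \<equiv> fb_step f g x \<alpha>"
  shows "p \<in> edom (objective f g)"
    and "y \<in> edom (objective f g) \<Longrightarrow>
      (norm (p - y))\<^sup>2 \<le> (norm (x - y))\<^sup>2 + 2 * \<alpha> * (rval (objective f g) y - rval (objective f g) p)"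
proof -
  note dom = edom_objective[OF f g]
  have xf: "x \<in> edom f" using cont_diff_atD(1)[OF cd] interior_subset by blast
  have "f p \<le> ereal (rval f x + (grad f x \<bullet> (p - x) + 1 / (2*\<alpha>) * (norm (x - p))\<^sup>2))"
    using dec Gamma0_ereal[OF f xf] unfolding sufficient_decrease_def p_def by (metis plus_ereal.simps(1))
  hence pf: "p \<in> edom f" "rval f p \<le> rval f x + (grad f x \<bullet> (p - x) + 1 / (2*\<alpha>) * (norm (x - p))\<^sup>2)"
    unfolding Gamma0_le_iff[OF f] by auto
  have pg: "p \<in> edom g" using fb_step_variational(1)[OF g \<alpha>] p_def by blast
  show "p \<in> edom (objective f g)" using pf pg dom(1) by simp
  assume y: "y \<in> edom (objective f g)"
  have yf: "y \<in> edom f" and yg: "y \<in> edom g" using y dom(1) by auto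
  have 1: "rval f x + grad f x \<bullet> (y - x) \<le> rval f y" using cont_diff_at_grad_inequality[OF f cd yf] .
  have 2: "rval g p + ((x - p) /\<^sub>R \<alpha> - grad f x) \<bullet> (y - p) \<le> rval g y"
    using fb_step_variational(2)[OF g \<alpha> yg] unfolding p_def .
  have "((x - p) /\<^sub>R \<alpha> - grad f x) \<bullet> (y - p) = (1/\<alpha>) * ((x - p) \<bullet> (y - p)) - grad f x \<bullet> (y - p)"
    by (simp add: inner_diff_left divide_inverse)
  moreover have "grad f x \<bullet> (y - p) + grad f x \<bullet> (p - x) = grad f x \<bullet> (y - x)"
    by (simp add: inner_diff_right)
  ultimately have "rval f p + rval g p + (1/\<alpha>) * ((x - p) \<bullet> (y - p)) \<le> rval f y + rval g y + 1 / (2*\<alpha>) * (norm (x - p))\<^sup>2"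
    using 1 2 pf(2) by linarith
  hence "2 * \<alpha> * (rval f p + rval g p + (1/\<alpha>) * ((x - p) \<bullet> (y - p))) \<le> 2 * \<alpha> * (rval f y + rval g y + 1 / (2*\<alpha>) * (norm (x - p))\<^sup>2)"
    using \<alpha> by (intro mult_left_mono) auto
  hence "2 * \<alpha> * (rval f p + rval g p) + 2 * ((x - p) \<bullet> (y - p)) \<le> 2 * \<alpha> * (rval f y + rval g y) + (norm (x - p))\<^sup>2"
    using \<alpha> by (simp add: algebra_simps)
  moreover have "(norm (x - y))\<^sup>2 = (norm (x - p))\<^sup>2 - 2 * ((x - p) \<bullet> (y - p)) + (norm (p - y))\<^sup>2"
    unfolding power2_norm_eq_inner by (simp add: inner_diff_left inner_diff_right inner_commute algebra_simps)
  ultimately show "(norm (p - y))\<^sup>2 \<le> (norm (x - y))\<^sup>2 + 2 * \<alpha> * (rval (objective f g) y - rval (objective f g) p)"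
    using dom(2) pf(1) pg yf yg by (simp add: right_diff_distrib)
qed

text \<open>The variational inequality at \<open>y = x\<close>; strong convexity of the proximal problem accounts for the
  weight \<open>1 / \<alpha>\<close> on the squared step length.\<close>
lemma fb_step_decrease:
  fixes f g :: "real^'n \<Rightarrow> ereal" and x :: "real^'n"
  assumes g: "g \<in> Gamma0" and \<alpha>: "\<alpha> > 0" and x: "x \<in> edom g"
  defines "p \<equiv> fb_step f g x \<alpha>"
  shows "rval g p + (1/\<alpha>) * (norm (p - x))\<^sup>2 + grad f x \<bullet> (p - x) \<le> rval g x"
proof -
  have "rval g p + ((x - p) /\<^sub>R \<alpha> - grad f x) \<bullet> (x - p) \<le> rval g x"
    using fb_step_variational(2)[OF g \<alpha> x] unfolding p_def .
  moreover have "((x - p) /\<^sub>R \<alpha>) \<bullet> (x - p) = (1/\<alpha>) * (norm (p - x))\<^sup>2"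
    by (simp add: divide_inverse norm_minus_commute flip: power2_norm_eq_inner)
  moreover have "grad f x \<bullet> (x - p) = - (grad f x \<bullet> (p - x))" by (simp add: inner_diff_right)
  ultimately show ?thesis by (simp add: inner_diff_left)
qed

lemma sufficient_decreaseI:
  fixes f g :: "real^'n \<Rightarrow> ereal" and x :: "real^'n"
  assumes f: "f \<in> Gamma0" and x: "x \<in> edom f" and \<alpha>: "\<alpha> > 0"
  defines "p \<equiv> fb_step f g x \<alpha>"
  assumes p: "p \<in> edom f" "GDERIV (rval f) p :> grad f p"
    and le: "norm (grad f p - grad f x) \<le> norm (p - x) / (2 * \<alpha>)"
  shows "sufficient_decrease f g x \<alpha>"
proof -
  have "norm (grad f p - grad f x) * norm (p - x) \<le> norm (p - x) / (2 * \<alpha>) * norm (p - x)"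
    using le by (intro mult_right_mono) auto
  also have "\<dots> = 1 / (2*\<alpha>) * (norm (x - p))\<^sup>2" by (simp add: power2_eq_square norm_minus_commute)
  finally have "rval f p \<le> rval f x + (grad f x \<bullet> (p - x) + 1 / (2*\<alpha>) * (norm (x - p))\<^sup>2)"
    using linearization_error_le[OF f p x] by linarith
  hence "f p \<le> ereal (rval f x + (grad f x \<bullet> (p - x) + 1 / (2*\<alpha>) * (norm (x - p))\<^sup>2))"
    using p(1) by (simp add: Gamma0_le_iff[OF f])
  thus ?thesis unfolding sufficient_decrease_def p_def[symmetric] using Gamma0_ereal[OF f x]
    by (metis plus_ereal.simps(1))
qed

section \<open>Acceptance of small steps\<close>

text \<open>The difficulty is that the trial point \<open>p\<close> might lie outside the interior of \<open>dom f\<close>, where nothing is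
  known about \<open>\<nabla>f\<close>. Along the segment from \<open>x\<close> to \<open>p\<close>, however, as long as the segment stays in the
  interior, the Lipschitz bound keeps the objective from rising above its value at \<open>x\<close>. The
  parameters of the points that lie in the interior form an open set, and a closed one: a limit point
  inherits the bound by lower semicontinuity, so (A2) puts it into the interior as well. By
  connectedness \<open>p\<close> is an interior point, and the Lipschitz bound applies there.\<close>
lemma sufficient_decrease_global_Lipschitz:
  fixes f g :: "real^'n \<Rightarrow> ereal" and x :: "real^'n"
  assumes A1: "assumption_A1 f g" and A2: "assumption_A2 f g"
    and FG: "objective f g \<in> Gamma0"
    and lip: "L-lipschitz_on (admissible f g) (grad f)" and L: "L > 0"
    and x: "x \<in> admissible f g" and \<alpha>: "0 < \<alpha>" "\<alpha> \<le> 1 / (2 * L)"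
  shows "sufficient_decrease f g x \<alpha>"
proof -
  have f: "f \<in> Gamma0" and g: "g \<in> Gamma0" using A1 by (auto simp: assumption_A1_def)
  let ?F = "objective f g" and ?p = "fb_step f g x \<alpha>"
  note dom = edom_objective[OF f g]
  have xf: "x \<in> edom f" and xg: "x \<in> edom g" and xi: "x \<in> interior (edom f)"
    using x interior_subset by (auto simp: admissible_def)
  hence xF: "x \<in> edom ?F" using dom by simp
  have cd: "cont_diff_at f y" if "y \<in> admissible f g" for y
    using A2 that unfolding assumption_A2_def by blast
  have gd: "GDERIV (rval f) y :> grad f y" if "y \<in> admissible f g" for y
    using cont_diff_atD(3)[OF cd[OF that]] by (metis centre_in_ball)
  have pg: "?p \<in> edom g" using fb_step_variational(1)[OF g \<alpha>(1)] .
  have inv: "L \<le> 1 / (2 * \<alpha>)" using \<alpha> L by (simp add: field_simps)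
  define e where "e = norm (?p - x)"
  have var': "rval g ?p + (1/\<alpha>) * e\<^sup>2 + grad f x \<bullet> (?p - x) \<le> rval g x"
    using fb_step_decrease[OF g \<alpha>(1) xg] unfolding e_def .
  define y where "y = (\<lambda>t. (1 - t) *\<^sub>R x + t *\<^sub>R ?p)"
  have yx: "y t - x = t *\<^sub>R (?p - x)" for t unfolding y_def by (simp add: algebra_simps)
  have cont: "continuous_on UNIV y" unfolding y_def by (intro continuous_intros)
  have ygm: "y t \<in> edom g" "rval g (y t) \<le> (1 - t) * rval g x + t * rval g ?p" if "0 \<le> t" "t \<le> 1" for t
    using Gamma0_convexD[OF g xg pg that] unfolding y_def by auto
  have down: "?F (y t) \<le> ?F x" if t: "0 \<le> t" "t \<le> 1" and int: "y t \<in> interior (edom f)" for t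
  proof -
    have yadm: "y t \<in> admissible f g" using ygm t int by (auto simp: admissible_def)
    have yf: "y t \<in> edom f" using int interior_subset by blast
    have "rval f (y t) \<le> rval f x + grad f x \<bullet> (y t - x) + norm (grad f (y t) - grad f x) * norm (y t - x)"
      using linearization_error_le[OF f yf gd[OF yadm] xf] .
    also have "norm (grad f (y t) - grad f x) \<le> L * norm (y t - x)"
      using lipschitz_onD[OF lip yadm x] by (simp add: dist_norm)
    hence "norm (grad f (y t) - grad f x) * norm (y t - x) \<le> L * norm (y t - x) * norm (y t - x)"
      by (rule mult_right_mono) simp
    also have "L * norm (y t - x) * norm (y t - x) = t\<^sup>2 * (L * e\<^sup>2)"
      unfolding yx e_def using t by (simp add: power2_eq_square)
    also have "\<dots> \<le> t * (1 / \<alpha> * e\<^sup>2)"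
    proof -
      have "L * e\<^sup>2 \<le> 1 / \<alpha> * e\<^sup>2" using inv \<alpha> L by (intro mult_right_mono) (auto simp: field_simps)
      moreover have "t\<^sup>2 \<le> t" using t by (simp add: power2_eq_square mult_left_le)
      moreover have "0 \<le> L * e\<^sup>2" using L by simp
      ultimately show ?thesis using t by (meson mult_mono order_trans)
    qed
    finally have "rval f (y t) + rval g (y t) \<le>
        rval f x + grad f x \<bullet> (y t - x) + t * (1 / \<alpha> * e\<^sup>2) + ((1 - t) * rval g x + t * rval g ?p)"
      using ygm(2)[OF t] by linarith
    also have "\<dots> = rval f x + rval g x + t * (rval g ?p + (1/\<alpha>) * e\<^sup>2 + grad f x \<bullet> (?p - x) - rval g x)"
      unfolding yx by (simp add: algebra_simps)
    also have "\<dots> \<le> rval f x + rval g x"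
      using var' t by (simp add: mult_nonneg_nonpos)
    finally have "rval ?F (y t) \<le> rval ?F x" using dom(2) yf ygm(1)[OF t] xf xg by simp
    moreover have "y t \<in> edom ?F" using dom yf ygm(1)[OF t] by simp
    ultimately show ?thesis using Gamma0_ereal[OF FG] xF by (metis ereal_less_eq(3))
  qed
  let ?T = "{t \<in> {0..1}. y t \<in> interior (edom f)}"
  have "?T = {0..1}"
  proof -
    have "openin (top_of_set {0..1}) ?T"
    proof -
      have "?T = {0..1} \<inter> (y -` interior (edom f))" by auto
      moreover have "open (y -` interior (edom f))" using cont by (intro open_vimage) auto
      ultimately show ?thesis by (metis openin_open_Int)
    qed
    moreover have "closedin (top_of_set {0..1}) ?T"
    proof -
      have "closed ?T"
        unfolding closed_sequential_limits
      proof (intro allI impI, elim conjE)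
        fix X l assume X: "\<forall>n. X n \<in> ?T" "X \<longlonglongrightarrow> l"
        have l: "l \<in> {0..1}" using X closed_sequentially[of "{0..1::real}" X l] by auto
        have lim: "(\<lambda>n. y (X n)) \<longlonglongrightarrow> y l"
          using X(2) cont by (intro continuous_on_tendsto_compose[of UNIV y]) auto
        have le: "?F (y (X n)) \<le> ereal (rval ?F x)" for n
          using down[of "X n"] X(1) by (auto simp only: Gamma0_ereal[OF FG xF, symmetric] mem_Collect_eq atLeastAtMost_iff)
        have "lsc_fun ?F" using FG by (simp add: Gamma0_def)
        from lsc_fun_le_limit[OF this lim tendsto_const le] have "?F (y l) \<le> ereal (rval ?F x)" .
        hence "?F (y l) \<le> ?F x" by (simp only: Gamma0_ereal[OF FG xF, symmetric])
        hence "y l \<in> admissible f g" using A2 x unfolding assumption_A2_def by blast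
        thus "l \<in> ?T" using l by (auto simp: admissible_def)
      qed
      moreover have "?T \<subseteq> {0..1}" by blast
      ultimately show ?thesis by (intro closed_subset)
    qed
    moreover have "0 \<in> ?T" using xi by (simp add: y_def)
    moreover have "connected {0..1::real}" by simp
    ultimately show ?thesis unfolding connected_clopen by blast
  qed
  hence "y 1 \<in> interior (edom f)" by (metis (no_types, lifting) atLeastAtMost_iff mem_Collect_eq order_refl zero_le_one)
  hence padm: "?p \<in> admissible f g" using pg by (simp add: y_def admissible_def)
  have "norm (grad f ?p - grad f x) \<le> L * norm (?p - x)"
    using lipschitz_onD[OF lip padm x] by (simp add: dist_norm)
  also have "\<dots> \<le> 1 / (2 * \<alpha>) * norm (?p - x)" using inv by (intro mult_right_mono) auto
  finally show ?thesis using padm interior_subset gd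
    by (intro sufficient_decreaseI[OF f xf \<alpha>(1)]) (auto simp: admissible_def)
qed

text \<open>A bound on \<open>e\<^sup>2\<close> by \<open>\<alpha>\<close> times an affine function of \<open>e\<close> first bounds \<open>e\<close> itself and then gives
  \<open>e\<^sup>2 = O(\<alpha>)\<close>.\<close>
lemma self_bounding_square:
  fixes e P Q \<alpha> :: real
  assumes "0 \<le> e" "0 \<le> P" "0 \<le> Q" "0 < \<alpha>" "\<alpha> \<le> 1" and le: "e\<^sup>2 \<le> \<alpha> * (P + Q * e)"
  shows "e\<^sup>2 \<le> \<alpha> * (P + Q * (P + Q + 1))"
proof -
  have "e \<le> P + Q + 1"
  proof (rule ccontr)
    assume "\<not> e \<le> P + Q + 1"
    hence e: "e > P + Q + 1" "e \<ge> 1" using assms by auto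
    have "\<alpha> * (P + Q * e) \<le> 1 * (P + Q * e)" using assms by (intro mult_right_mono) auto
    also have "P + Q * e \<le> P * e + Q * e" using assms e mult_left_mono[of 1 e P] by auto
    also have "\<dots> < e * e" using e assms by (simp add: distrib_right[symmetric])
    finally show False using le by (simp add: power2_eq_square)
  qed
  hence "\<alpha> * (P + Q * e) \<le> \<alpha> * (P + Q * (P + Q + 1))"
    using assms by (intro mult_left_mono add_left_mono) auto
  with le show ?thesis by linarith
qed

lemma stationary_imp_solution:
  fixes f g :: "real^'n \<Rightarrow> ereal"
  assumes f: "f \<in> Gamma0" and g: "g \<in> Gamma0" and cd: "cont_diff_at f x"
    and xg: "x \<in> edom g" and st: "\<And>y. y \<in> edom g \<Longrightarrow> rval g x - grad f x \<bullet> (y - x) \<le> rval g y"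
  shows "x \<in> solutions f g"
  unfolding solutions_def
proof (intro CollectI allI)
  fix y
  note dom = edom_objective[OF f g]
  have xf: "x \<in> edom f" using cont_diff_atD(1)[OF cd] interior_subset by blast
  show "objective f g x \<le> objective f g y"
  proof (cases "y \<in> edom (objective f g)")
    case False
    thus ?thesis using infinity_if_not_edom by (metis ereal_less_eq(1))
  next
    case True
    hence y: "y \<in> edom f" "y \<in> edom g" using dom by auto
    have "rval f x + rval g x \<le> rval f y + rval g y"
      using cont_diff_at_grad_inequality[OF f cd y(1)] st[OF y(2)] by linarith
    thus ?thesis using Gamma0_ereal[OF f] Gamma0_ereal[OF g] y xf xg unfolding objective_def
      by (metis ereal_less_eq(3) plus_ereal.simps(1))
  qed
qed

text \<open>Only continuity of \<open>\<nabla>f\<close> is available away from the solutions. Suppose that steps \<open>a\<^sub>n \<rightarrow> 0\<close> are rejected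
  at points \<open>x\<^sub>n \<rightarrow> l\<close>. The trial points \<open>p\<^sub>n\<close> also tend to \<open>l\<close>, and rejection forces
  \<open>\<parallel>p\<^sub>n - x\<^sub>n\<parallel> / (2 a\<^sub>n) < \<parallel>\<nabla>f(p\<^sub>n) - \<nabla>f(x\<^sub>n)\<parallel>\<close>, whose right-hand side vanishes in the limit. Hence the
  subgradients \<open>(x\<^sub>n - p\<^sub>n) / a\<^sub>n - \<nabla>f(x\<^sub>n)\<close> of \<open>g\<close> tend to \<open>- \<nabla>f(l)\<close>, which makes \<open>l\<close> a solution. But near a
  solution \<open>\<nabla>f\<close> is Lipschitz continuous, and there small steps are accepted: a contradiction.\<close>
lemma sufficient_decrease_compact:
  fixes f g :: "real^'n \<Rightarrow> ereal" and K :: "(real^'n) set"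
  assumes A1: "assumption_A1 f g" and A2: "assumption_A2 f g"
    and loc_lip: "\<forall>s\<in>solutions f g. \<exists>r>0. \<exists>L. L-lipschitz_on (ball s r) (grad f)"
    and K: "compact K" "K \<subseteq> admissible f g" and M: "\<And>x. x \<in> K \<Longrightarrow> rval (objective f g) x \<le> M"
  shows "\<exists>c>0. \<forall>x\<in>K. \<forall>\<alpha>. 0 < \<alpha> \<and> \<alpha> \<le> c \<longrightarrow> sufficient_decrease f g x \<alpha>"
proof (rule ccontr)
  have f: "f \<in> Gamma0" and g: "g \<in> Gamma0" using A1 by (auto simp: assumption_A1_def)
  note dom = edom_objective[OF f g]
  assume contr: "\<not> ?thesis"
  have "\<exists>x \<alpha>. x \<in> K \<and> 0 < \<alpha> \<and> \<alpha> \<le> inverse (real (Suc n)) \<and> \<not> sufficient_decrease f g x \<alpha>" for n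
  proof -
    have "inverse (real (Suc n)) > 0" by simp
    thus ?thesis using contr by blast
  qed
  then obtain X A where XA: "\<And>n. X n \<in> K" "\<And>n. 0 < A n" "\<And>n. A n \<le> inverse (real (Suc n))"
    "\<And>n. \<not> sufficient_decrease f g (X n) (A n)" by metis
  obtain l r where l: "l \<in> K" and r: "strict_mono r" and lim: "(X \<circ> r) \<longlonglongrightarrow> l"
    using K(1) XA(1) unfolding compact_def by meson
  define x where "x n = X (r n)" for n
  define a where "a n = A (r n)" for n
  define p where "p n = fb_step f g (x n) (a n)" for n
  define e where "e n = norm (p n - x n)" for n
  have x_lim: "x \<longlonglongrightarrow> l" using lim by (simp add: x_def[abs_def] comp_def)
  have xK: "x n \<in> K" and a_pos: "0 < a n" and fail: "\<not> sufficient_decrease f g (x n) (a n)" for n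
    using XA by (auto simp: x_def a_def)
  have xf: "x n \<in> edom f" and xg: "x n \<in> edom g" for n
    using xK[of n] K(2) interior_subset by (auto simp: admissible_def)
  have "A \<longlonglongrightarrow> 0"
  proof (rule tendsto_sandwich[OF _ _ tendsto_const LIMSEQ_inverse_real_of_nat])
    show "\<forall>\<^sub>F n in sequentially. 0 \<le> A n" using XA(2) by (intro always_eventually allI less_imp_le)
    show "\<forall>\<^sub>F n in sequentially. A n \<le> inverse (real (Suc n))" using XA(3) by (intro always_eventually allI)
  qed
  hence a_lim: "a \<longlonglongrightarrow> 0" unfolding a_def using r LIMSEQ_subseq_LIMSEQ[of A 0 r] by (simp add: comp_def)
  have a1: "a n \<le> 1" for n
  proof -
    have "inverse (real (Suc (r n))) \<le> 1" by (simp add: inverse_le_1_iff)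
    thus ?thesis using XA(3)[of "r n"] by (simp add: a_def)
  qed

  have l_adm: "l \<in> admissible f g" using l K by blast
  have lf: "l \<in> edom f" and lg: "l \<in> edom g" using l_adm interior_subset by (auto simp: admissible_def)
  have cd: "cont_diff_at f l" using A2 l_adm unfolding assumption_A2_def by blast
  note cont = cont_diff_atD(2)[OF cd]
  obtain R where R: "R > 0" "\<And>y. y \<in> ball l R \<Longrightarrow> y \<in> edom f \<and> GDERIV (rval f) y :> grad f y"
    using cont_diff_atD(3)[OF cd] interior_subset by blast
  have fcont: "isCont (rval f) l"
    using R(1) R(2)[of l] has_derivative_continuous unfolding gderiv_def by (metis centre_in_ball)
  have grad_x: "(\<lambda>n. grad f (x n)) \<longlonglongrightarrow> grad f l"
    using isCont_tendsto_compose[OF cont x_lim] .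
  have f_x: "(\<lambda>n. rval f (x n)) \<longlonglongrightarrow> rval f l"
    using isCont_tendsto_compose[OF fcont x_lim] .

  \<comment> \<open>The affine bound on \<open>e\<^sup>2 / a\<close> comes from an upper bound of \<open>g\<close> at \<open>x\<^sub>n\<close>, the norm minorant of \<open>g\<close> at
    \<open>p\<^sub>n\<close> and the boundedness of the gradients.\<close>
  have "e \<longlonglongrightarrow> 0"
  proof -
    obtain B1 where B1: "\<And>n. \<bar>rval f (x n)\<bar> \<le> B1"
      using convergent_imp_Bseq[OF convergentI[OF f_x]] unfolding Bseq_def by auto
    obtain B2 where B2: "\<And>n. norm (grad f (x n)) \<le> B2"
      using convergent_imp_Bseq[OF convergentI[OF grad_x]] unfolding Bseq_def by auto
    obtain B3 where B3: "\<And>n. norm (x n) \<le> B3"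
      using convergent_imp_Bseq[OF convergentI[OF x_lim]] unfolding Bseq_def by auto
    obtain a0 b where ab: "0 \<le> b" "\<And>y. y \<in> edom g \<Longrightarrow> a0 - b * norm y \<le> rval g y"
      using Gamma0_norm_minorant[OF g] by blast
    define P where "P = \<bar>M + B1 - a0 + b * B3\<bar>"
    define Q where "Q = b + B2"
    have Q: "Q \<ge> 0" using ab(1) B2[of 0] norm_ge_zero[of "grad f (x 0)"] unfolding Q_def by linarith
    have sq: "(e n)\<^sup>2 \<le> a n * (P + Q * (P + Q + 1))" for n
    proof (rule self_bounding_square)
      have "(1 / a n) * (e n)\<^sup>2 \<le> rval g (x n) - rval g (p n) - grad f (x n) \<bullet> (p n - x n)"
        using fb_step_decrease[OF g a_pos[of n] xg[of n], where f = f] unfolding e_def p_def by linarith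
      moreover have "rval g (x n) \<le> M + B1"
      proof -
        have "rval (objective f g) (x n) = rval f (x n) + rval g (x n)" using dom(2) xf xg by blast
        thus ?thesis using M[OF xK[of n]] B1[of n] by linarith
      qed
      moreover have "- rval g (p n) \<le> - a0 + b * (B3 + e n)"
      proof -
        have "a0 - b * norm (p n) \<le> rval g (p n)"
          using ab(2) fb_step_variational(1)[OF g a_pos] unfolding p_def by blast
        moreover have "b * norm (p n) \<le> b * (B3 + e n)"
          using B3[of n] norm_triangle_sub[of "p n" "x n"] ab(1) unfolding e_def by (intro mult_left_mono) auto
        ultimately show ?thesis by linarith
      qed
      moreover have "- (grad f (x n) \<bullet> (p n - x n)) \<le> B2 * e n"
      proof -
        have "- (grad f (x n) \<bullet> (p n - x n)) \<le> norm (grad f (x n)) * e n"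
          unfolding e_def using Cauchy_Schwarz_ineq2[of "grad f (x n)" "p n - x n"] by linarith
        also have "\<dots> \<le> B2 * e n" using B2 by (intro mult_right_mono) (auto simp: e_def)
        finally show ?thesis .
      qed
      ultimately have "(1 / a n) * (e n)\<^sup>2 \<le> P + Q * e n"
        unfolding P_def Q_def distrib_left distrib_right by linarith
      thus "(e n)\<^sup>2 \<le> a n * (P + Q * e n)" using a_pos[of n] by (simp add: field_simps)
    qed (use a_pos a1 Q in \<open>auto simp: e_def P_def\<close>)
    have "(\<lambda>n. a n * (P + Q * (P + Q + 1))) \<longlonglongrightarrow> 0 * (P + Q * (P + Q + 1))"
      by (intro tendsto_intros a_lim)
    hence "(\<lambda>n. (e n)\<^sup>2) \<longlonglongrightarrow> 0"
      by (intro tendsto_sandwich[OF _ _ tendsto_const, of _ "\<lambda>n. (e n)\<^sup>2"]) (auto intro!: always_eventually sq)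
    hence "(\<lambda>n. sqrt ((e n)\<^sup>2)) \<longlonglongrightarrow> sqrt 0" by (intro tendsto_intros)
    thus ?thesis by (simp add: e_def[abs_def])
  qed
  hence px: "(\<lambda>n. p n - x n) \<longlonglongrightarrow> 0" unfolding e_def by (rule tendsto_norm_zero_cancel)
  hence p_lim: "p \<longlonglongrightarrow> l" using tendsto_add[OF px x_lim] by simp
  have grad_p: "(\<lambda>n. grad f (p n)) \<longlonglongrightarrow> grad f l"
    using isCont_tendsto_compose[OF cont p_lim] .

  have big: "\<forall>\<^sub>F n in sequentially. e n / (2 * a n) < norm (grad f (p n) - grad f (x n))"
  proof -
    have "\<forall>\<^sub>F n in sequentially. p n \<in> ball l R"
      using R(1) p_lim by (intro topological_tendstoD) auto
    thus ?thesis
    proof eventually_elim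
      case (elim n)
      show ?case
      proof (rule ccontr)
        assume "\<not> ?thesis"
        hence "sufficient_decrease f g (x n) (a n)"
          using R(2)[OF elim] sufficient_decreaseI[OF f xf[of n] a_pos[of n], where g = g]
          unfolding p_def e_def by auto
        thus False using fail by blast
      qed
    qed
  qed
  have "(\<lambda>n. norm (grad f (p n) - grad f (x n))) \<longlonglongrightarrow> norm (grad f l - grad f l)"
    by (intro tendsto_intros grad_p grad_x)
  hence grad_diff: "(\<lambda>n. norm (grad f (p n) - grad f (x n))) \<longlonglongrightarrow> 0" by simp
  have "(\<lambda>n. e n / (2 * a n)) \<longlonglongrightarrow> 0"
  proof (rule tendsto_sandwich[OF _ _ tendsto_const grad_diff])
    show "\<forall>\<^sub>F n in sequentially. 0 \<le> e n / (2 * a n)"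
      using a_pos by (intro always_eventually allI divide_nonneg_pos) (auto simp: e_def)
    show "\<forall>\<^sub>F n in sequentially. e n / (2 * a n) \<le> norm (grad f (p n) - grad f (x n))"
      using big by eventually_elim simp
  qed
  hence "(\<lambda>n. 2 * (e n / (2 * a n))) \<longlonglongrightarrow> 2 * 0" by (intro tendsto_intros)
  moreover have "2 * (e n / (2 * a n)) = norm ((x n - p n) /\<^sub>R a n)" for n
  proof -
    have "norm ((x n - p n) /\<^sub>R a n) = inverse (a n) * e n"
      using a_pos[of n] by (simp only: norm_scaleR abs_inverse abs_of_pos e_def norm_minus_commute[of "p n" "x n"])
    also have "\<dots> = 2 * (e n / (2 * a n))" using a_pos[of n] by (simp add: field_simps)
    finally show ?thesis by (rule sym)
  qed
  ultimately have "(\<lambda>n. norm ((x n - p n) /\<^sub>R a n)) \<longlonglongrightarrow> 0" by (simp only: mult_zero_right)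
  hence slope: "(\<lambda>n. (x n - p n) /\<^sub>R a n) \<longlonglongrightarrow> 0" by (rule tendsto_norm_zero_cancel)

  have "l \<in> solutions f g"
  proof (rule stationary_imp_solution[OF f g cd lg])
    fix y assume y: "y \<in> edom g"
    have "(\<lambda>n. rval g y - ((x n - p n) /\<^sub>R a n - grad f (x n)) \<bullet> (y - p n))
        \<longlonglongrightarrow> rval g y - (0 - grad f l) \<bullet> (y - l)"
      by (intro tendsto_intros slope grad_x p_lim)
    moreover have "rval g (p n) \<le> rval g y - ((x n - p n) /\<^sub>R a n - grad f (x n)) \<bullet> (y - p n)" for n
      using fb_step_variational(2)[OF g a_pos[of n] y, where f = f and x = "x n"] unfolding p_def by linarith
    moreover have "p n \<in> edom g" for n using fb_step_variational(1)[OF g a_pos] unfolding p_def by blast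
    ultimately have "rval g l \<le> rval g y - (0 - grad f l) \<bullet> (y - l)"
      using Gamma0_lower_limit[OF g p_lim] by blast
    thus "rval g l - grad f l \<bullet> (y - l) \<le> rval g y" by simp
  qed
  then obtain R' L where R': "R' > 0" and lip: "L-lipschitz_on (ball l R') (grad f)" using loc_lip by blast
  have "L \<ge> 0" using lip by (rule lipschitz_on_nonneg)
  have "\<forall>\<^sub>F n in sequentially. x n \<in> ball l R'" "\<forall>\<^sub>F n in sequentially. p n \<in> ball l R'"
    using R' by (auto intro: topological_tendstoD[OF x_lim] topological_tendstoD[OF p_lim] simp del: mem_ball)
  moreover have "\<forall>\<^sub>F n in sequentially. a n < 1 / (2 * (L + 1))"
    using a_lim \<open>L \<ge> 0\<close> by (intro order_tendstoD) auto
  ultimately have "\<forall>\<^sub>F n in sequentially. False"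
    using big
  proof eventually_elim
    case (elim n)
    have "norm (grad f (p n) - grad f (x n)) \<le> L * e n"
      using lipschitz_onD[OF lip elim(2,1)] by (simp add: dist_norm e_def)
    hence "e n / (2 * a n) < L * e n" using elim by linarith
    hence "e n < 2 * a n * (L * e n)" using a_pos[of n] by (simp add: field_simps)
    also have "\<dots> = (2 * a n * L) * e n" by simp
    also have "\<dots> \<le> 1 * e n"
    proof (rule mult_right_mono)
      have "2 * a n * L \<le> 2 * a n * (L + 1)" using a_pos[of n] by simp
      also have "\<dots> \<le> 1" using elim(3) \<open>L \<ge> 0\<close> by (simp add: field_simps)
      finally show "2 * a n * L \<le> 1" .
    qed (simp add: e_def)
    finally show False by simp
  qed
  thus False by simp
qed

section \<open>Quadratic growth of piecewise linear-quadratic functions\<close>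

text \<open>Moving from a zero \<open>d\<close> of the form by \<open>- s (A d)\<close> changes its value by \<open>- 2 s \<parallel>A d\<parallel>\<^sup>2\<close> to first order in \<open>s\<close>,
  which nonnegativity forbids unless \<open>A d = 0\<close>.\<close>
lemma psd_kernel:
  fixes A :: "real^'n^'n"
  assumes sym: "transpose A = A" and psd: "\<And>v. 0 \<le> v \<bullet> (A *v v)" and d: "d \<bullet> (A *v d) = 0"
  shows "A *v d = 0"
proof -
  define e where "e = A *v d"
  define \<kappa> where "\<kappa> = e \<bullet> (A *v e)"
  have swap: "u \<bullet> (A *v w) = (A *v u) \<bullet> w" for u w
    using sym by (metis dot_lmul_matrix transpose_matrix_vector)
  have "e \<bullet> e \<le> 0"
  proof (rule le_of_forall_small_slack)
    fix s :: real assume s: "0 < s" "s < 1"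
    have "0 \<le> (d - s *\<^sub>R e) \<bullet> (A *v (d - s *\<^sub>R e))" by (rule psd)
    also have "\<dots> = - (2 * s * (e \<bullet> e)) + s * s * \<kappa>"
      using d swap[of d e]
      unfolding matrix_vector_mult_diff_distrib matrix_vector_mult_scaleR inner_diff_left inner_diff_right
        inner_scaleR_left inner_scaleR_right e_def[symmetric] \<kappa>_def
      by (simp add: inner_commute algebra_simps)
    finally have "s * (e \<bullet> e) \<le> s * (s * (\<kappa> / 2))" by simp
    thus "e \<bullet> e \<le> 0 + s * (\<kappa> / 2)" using s by simp
  qed
  thus ?thesis unfolding e_def by (metis inner_gt_zero_iff not_le)
qed

lemma polyhedron_inequalities:
  fixes C :: "'a::euclidean_space set"
  assumes "polyhedron C"
  shows "\<exists>I::('a \<times> real) set. finite I \<and> C = {x. \<forall>i\<in>I. fst i \<bullet> x \<le> snd i}"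
proof -
  obtain H where H: "finite H" "C = \<Inter>H" "\<And>h. h \<in> H \<Longrightarrow> \<exists>a b. a \<noteq> 0 \<and> h = {x. a \<bullet> x \<le> b}"
    using assms unfolding polyhedron_def by blast
  obtain a b where ab: "\<And>h. h \<in> H \<Longrightarrow> h = {x. a h \<bullet> x \<le> b h}" using H(3) by metis
  have "C = {x. \<forall>i\<in>(\<lambda>h. (a h, b h)) ` H. fst i \<bullet> x \<le> snd i}"
    using H(2) ab by auto
  thus ?thesis using H(1) by blast
qed

text \<open>Inactive constraints have positive slack at \<open>p\<close>, which a short step cannot use up.\<close>
lemma active_constraints_feasible:
  fixes p e :: "'a::euclidean_space"
  assumes fin: "finite I" and p: "\<forall>i\<in>I. fst i \<bullet> p \<le> snd i"
    and e: "\<forall>i\<in>I. fst i \<bullet> p = snd i \<longrightarrow> fst i \<bullet> e \<le> 0"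
  shows "\<exists>t>0. \<forall>i\<in>I. fst i \<bullet> (p + t *\<^sub>R e) \<le> (snd i :: real)"
proof -
  have "\<forall>\<^sub>F t in at_right 0. fst i \<bullet> (p + t *\<^sub>R e) \<le> snd i" if i: "i \<in> I" for i
  proof (cases "fst i \<bullet> p = snd i")
    case True
    hence "fst i \<bullet> (p + t *\<^sub>R e) \<le> snd i" if "t > 0" for t
      using e i that by (simp add: inner_add_right mult_nonneg_nonpos)
    thus ?thesis unfolding eventually_at_right_field by (intro exI[of _ 1]) auto
  next
    case False
    have "((\<lambda>t. fst i \<bullet> (p + t *\<^sub>R e)) \<longlongrightarrow> fst i \<bullet> (p + 0 *\<^sub>R e)) (at_right 0)"
      by (intro tendsto_intros)
    moreover have "fst i \<bullet> (p + 0 *\<^sub>R e) < snd i" using False p i by (simp add: order_less_le)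
    ultimately have "\<forall>\<^sub>F t in at_right 0. fst i \<bullet> (p + t *\<^sub>R e) < snd i" by (rule order_tendstoD(2))
    thus ?thesis by eventually_elim simp
  qed
  hence "\<forall>\<^sub>F t in at_right 0. \<forall>i\<in>I. fst i \<bullet> (p + t *\<^sub>R e) \<le> snd i"
    using fin by (simp add: eventually_ball_finite)
  then obtain b where "b > 0" "\<And>t. 0 < t \<Longrightarrow> t < b \<Longrightarrow> \<forall>i\<in>I. fst i \<bullet> (p + t *\<^sub>R e) \<le> snd i"
    unfolding eventually_at_right_field by auto
  thus ?thesis by (intro exI[of _ "b/2"]) auto
qed

text \<open>Write \<open>q(x) - m = w \<bullet> d + 1/2 (d \<bullet> A d)\<close> with \<open>w\<close> the gradient at a minimizer and \<open>d = x - p\<close> the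
  displacement from the projection \<open>p\<close> of \<open>x\<close> onto \<open>S\<close>. Both terms are nonnegative, and a feasible
  direction on which both vanish leads from \<open>p\<close> to other points of \<open>S\<close>. A displacement that comes from a
  projection cannot point into such directions, so \<open>w \<bullet> d + d \<bullet> A d\<close> is positive on the unit
  displacements. These lie in finitely many closed cones, one for each set of active constraints, and
  compactness turns positivity into a lower bound \<open>\<eta>\<close>. For \<open>\<parallel>d\<parallel> \<le> 1\<close> the linear term dominates its
  quadratic rescaling, which gives growth of order \<open>\<parallel>d\<parallel>\<^sup>2\<close>.

  The constant depends on the piece but not on the position of \<open>x\<close> or of its projection; this is what
  makes the rates uniform when the solution set is unbounded.\<close>
lemma quadratic_growth_polyhedron:
  fixes C :: "(real^'n) set" and A :: "real^'n^'n" and b :: "real^'n" and c m :: real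
  defines "q \<equiv> \<lambda>x. 1/2 * (x \<bullet> (A *v x)) + b \<bullet> x + c"
  defines "S \<equiv> {x\<in>C. q x = m}"
  assumes poly: "polyhedron C" and sym: "transpose A = A" and psd: "\<And>v. 0 \<le> v \<bullet> (A *v v)"
    and low: "\<And>x. x \<in> C \<Longrightarrow> m \<le> q x" and ne: "S \<noteq> {}"
  shows "\<exists>\<eta>>0. \<forall>x\<in>C. infdist x S \<le> 1 \<longrightarrow> \<eta> * (infdist x S)\<^sup>2 \<le> q x - m"
proof -
  obtain z where z: "z \<in> C" "q z = m" using ne S_def by auto
  define w where "w = A *v z + b"
  have swap: "u \<bullet> (A *v v) = (A *v u) \<bullet> v" for u v
    using sym by (metis dot_lmul_matrix transpose_matrix_vector)
  have expand: "q x = m + w \<bullet> (x - z) + 1/2 * ((x - z) \<bullet> (A *v (x - z)))" for x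
    unfolding z(2)[symmetric] q_def w_def matrix_vector_mult_diff_distrib inner_diff_left inner_diff_right
      inner_add_left
    using swap[of z x] swap[of z z] by (simp add: inner_commute algebra_simps)
  have convC: "convex C" and closC: "closed C" using poly polyhedron_imp_convex polyhedron_imp_closed by auto
  have first_order: "0 \<le> w \<bullet> (x - z)" if x: "x \<in> C" for x
  proof (rule le_of_forall_small_slack)
    fix t :: real assume t: "0 < t" "t < 1"
    have "(1 - t) *\<^sub>R z + t *\<^sub>R x \<in> C" using convexD_alt[OF convC z(1) x, of t] t by simp
    moreover have "(1 - t) *\<^sub>R z + t *\<^sub>R x = z + t *\<^sub>R (x - z)" by (simp add: algebra_simps)
    ultimately have "m \<le> q (z + t *\<^sub>R (x - z))" using low by metis
    hence "0 \<le> t * (w \<bullet> (x - z) + t * (1/2 * ((x - z) \<bullet> (A *v (x - z)))))"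
      unfolding expand by (simp add: matrix_vector_mult_scaleR algebra_simps)
    thus "0 \<le> w \<bullet> (x - z) + t * (1/2 * ((x - z) \<bullet> (A *v (x - z))))"
      using t by (simp add: zero_le_mult_iff)
  qed
  have S_eq: "S = {x\<in>C. A *v (x - z) = 0 \<and> w \<bullet> (x - z) = 0}"
  proof (intro set_eqI iffI)
    fix x assume "x \<in> S"
    hence x: "x \<in> C" "q x = m" by (auto simp: S_def)
    hence "w \<bullet> (x - z) = 0 \<and> (x - z) \<bullet> (A *v (x - z)) = 0"
      using expand[of x] first_order[OF x(1)] psd[of "x - z"] by linarith
    thus "x \<in> {x\<in>C. A *v (x - z) = 0 \<and> w \<bullet> (x - z) = 0}" using psd_kernel[OF sym psd] x by blast
  qed (use expand in \<open>auto simp: S_def\<close>)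
  have convS: "convex S" unfolding convex_alt
  proof (intro ballI allI impI)
    fix x y u assume xy: "x \<in> S" "y \<in> S" and u: "0 \<le> u \<and> u \<le> (1::real)"
    have e: "(1 - u) *\<^sub>R x + u *\<^sub>R y - z = (1 - u) *\<^sub>R (x - z) + u *\<^sub>R (y - z)" by (simp add: algebra_simps)
    show "(1 - u) *\<^sub>R x + u *\<^sub>R y \<in> S"
      using xy convexD_alt[OF convC, of x y u] u
      unfolding S_eq mem_Collect_eq e matrix_vector_right_distrib matrix_vector_mult_scaleR
        inner_add_right inner_scaleR_right by simp
  qed
  have contA: "continuous_on UNIV (\<lambda>x. A *v x)" by (intro linear_continuous_on matrix_vector_mul_bounded_linear)
  have contAc: "continuous_on UNIV (\<lambda>x. A *v (x - z))"
    by (rule continuous_on_compose2[OF contA]) (auto intro!: continuous_intros)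
  have closS: "closed S"
  proof -
    have "closed {x. A *v (x - z) = 0}" "closed {x. w \<bullet> (x - z) = 0}"
      by (intro closed_Collect_eq contAc continuous_intros)+
    hence "closed (C \<inter> ({x. A *v (x - z) = 0} \<inter> {x. w \<bullet> (x - z) = 0}))" using closC by blast
    moreover have "C \<inter> ({x. A *v (x - z) = 0} \<inter> {x. w \<bullet> (x - z) = 0}) = S" unfolding S_eq by auto
    ultimately show ?thesis by simp
  qed
  obtain I :: "((real^'n) \<times> real) set" where I: "finite I" "C = {x. \<forall>i\<in>I. fst i \<bullet> x \<le> snd i}"
    using polyhedron_inequalities[OF poly] by blast
  \<comment> \<open>\<open>T J\<close> are the directions feasible for the constraints in \<open>J\<close>, \<open>N J\<close> those that moreover stay in \<open>S\<close>, and
    \<open>Q J\<close> contains every displacement \<open>x - p\<close> from a projection \<open>p\<close> whose active constraints are \<open>J\<close>.\<close>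
  define T where "T J = {d. (\<forall>i\<in>J. fst i \<bullet> d \<le> 0)}" for J :: "((real^'n) \<times> real) set"
  define N where "N J = {e \<in> T J. A *v e = 0 \<and> w \<bullet> e = 0}" for J
  define Q where "Q J = {d \<in> T J. 0 \<le> w \<bullet> d \<and> (\<forall>e\<in>N J. d \<bullet> e \<le> 0)}" for J
  define B where "B = (\<Union>J\<in>Pow I. sphere 0 1 \<inter> Q J)"
  define \<phi> where "\<phi> d = w \<bullet> d + d \<bullet> (A *v d)" for d
  have "compact B" unfolding B_def
  proof (intro compact_UN)
    show "finite (Pow I)" using I(1) by simp
    fix J
    have "Q J = (\<Inter>i\<in>J. {d. fst i \<bullet> d \<le> 0}) \<inter> {d. 0 \<le> w \<bullet> d} \<inter> (\<Inter>e\<in>N J. {d. d \<bullet> e \<le> 0})"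
      by (auto simp: Q_def T_def)
    moreover have "closed \<dots>"
      by (intro closed_Int closed_INT ballI closed_Collect_le continuous_intros)
    ultimately have "closed (Q J)" by simp
    thus "compact (sphere 0 1 \<inter> Q J)" by (intro compact_Int_closed) auto
  qed
  have pos: "0 < \<phi> d" if dB: "d \<in> B" for d
  proof -
    obtain J where d: "norm d = 1" "d \<in> Q J" using dB by (auto simp: B_def)
    have "0 \<le> w \<bullet> d" "0 \<le> d \<bullet> (A *v d)" using d psd by (auto simp: Q_def)
    moreover have False if 0: "w \<bullet> d = 0" "d \<bullet> (A *v d) = 0"
    proof -
      have "d \<in> N J" using d 0 psd_kernel[OF sym psd] by (auto simp: N_def Q_def)
      hence "d \<bullet> d \<le> 0" using d by (auto simp: Q_def)
      thus False using d(1) by (metis inner_gt_zero_iff norm_zero not_le zero_neq_one)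
    qed
    ultimately show ?thesis unfolding \<phi>_def by (metis add_nonneg_eq_0_iff add_nonneg_nonneg order_less_le)
  qed
  obtain \<eta> where \<eta>: "\<eta> > 0" "\<And>d. d \<in> B \<Longrightarrow> \<eta> \<le> \<phi> d"
  proof (cases "B = {}")
    case True
    thus ?thesis using that[of 1] by auto
  next
    case False
    have "continuous_on B \<phi>" unfolding \<phi>_def
      by (intro continuous_intros continuous_on_subset[OF contA]) auto
    then obtain d where "d \<in> B" "\<forall>d'\<in>B. \<phi> d \<le> \<phi> d'"
      using continuous_attains_inf[OF \<open>compact B\<close> False] by blast
    thus ?thesis using that pos by blast
  qed
  have "\<eta> / 2 * (infdist x S)\<^sup>2 \<le> q x - m" if x: "x \<in> C" and near: "infdist x S \<le> 1" for x
  proof -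
    obtain p where p: "p \<in> S" "infdist x S = dist x p" using infdist_attains_inf[OF closS ne] by blast
    have pC: "p \<in> C" and pA: "A *v (p - z) = 0" and pw: "w \<bullet> (p - z) = 0" using p(1) S_eq by auto
    define d where "d = x - p"
    have xz: "x - z = d + (p - z)" by (simp add: d_def)
    have wd: "w \<bullet> (x - z) = w \<bullet> d" unfolding xz inner_add_right pw by simp
    have Axz: "A *v (x - z) = A *v d" unfolding xz matrix_vector_right_distrib pA by simp
    have "(x - z) \<bullet> (A *v (x - z)) = d \<bullet> (A *v d)"
      using swap[of "p - z" d] pA unfolding Axz unfolding xz inner_add_left by simp
    hence gap: "q x - m = w \<bullet> d + 1/2 * (d \<bullet> (A *v d))" using expand[of x] wd by simp
    define J where "J = {i\<in>I. fst i \<bullet> p = snd i}"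
    have "d \<in> Q J"
    proof -
      have "fst i \<bullet> d \<le> 0" if "i \<in> J" for i
        using that x I(2) unfolding J_def d_def by (auto simp: inner_diff_right)
      moreover have "0 \<le> w \<bullet> d" using first_order[OF x] wd by simp
      moreover have "d \<bullet> e \<le> 0" if e: "e \<in> N J" for e
      proof -
        have "\<forall>i\<in>I. fst i \<bullet> p \<le> snd i" using pC I(2) by auto
        moreover have "\<forall>i\<in>I. fst i \<bullet> p = snd i \<longrightarrow> fst i \<bullet> e \<le> 0"
          using e by (auto simp: N_def T_def J_def)
        ultimately obtain t where t: "t > 0" "\<forall>i\<in>I. fst i \<bullet> (p + t *\<^sub>R e) \<le> snd i"
          using active_constraints_feasible[OF I(1)] by metis
        have sh: "p + t *\<^sub>R e - z = t *\<^sub>R e + (p - z)" by simp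
        have "p + t *\<^sub>R e \<in> S"
          using t(2) I(2) pA pw e unfolding S_eq mem_Collect_eq sh
          by (simp add: matrix_vector_right_distrib matrix_vector_mult_scaleR inner_add_right N_def)
        moreover have "\<forall>y\<in>S. dist x p \<le> dist x y" using p(2) infdist_le by metis
        ultimately have "(x - p) \<bullet> (p + t *\<^sub>R e - p) \<le> 0"
          using any_closest_point_dot[OF convS closS p(1)] by blast
        thus ?thesis using t(1) by (simp add: d_def mult_le_0_iff)
      qed
      ultimately show ?thesis by (auto simp: Q_def T_def)
    qed
    show ?thesis
    proof (cases "d = 0")
      case True
      thus ?thesis using p(2) low[OF x] by (simp add: d_def)
    next
      case False
      define r where "r = norm d"
      have r: "0 < r" "r \<le> 1" using False near p(2) by (auto simp: r_def d_def dist_norm)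
      define u where "u = d /\<^sub>R r"
      have du: "d = r *\<^sub>R u" using r by (simp add: u_def)
      have "u \<in> Q J"
        using \<open>d \<in> Q J\<close> r unfolding du Q_def T_def by (auto simp: mult_le_0_iff zero_le_mult_iff)
      moreover have "norm u = 1" using r by (simp add: u_def r_def)
      ultimately have uB: "u \<in> B" by (auto simp: B_def J_def)
      have wu: "0 \<le> w \<bullet> u" using \<open>u \<in> Q J\<close> by (simp add: Q_def)
      have "\<eta> / 2 * r\<^sup>2 \<le> 1/2 * \<phi> u * r\<^sup>2" using \<eta>(2)[OF uB] by (intro mult_right_mono) auto
      also have "\<dots> = 1/2 * (r\<^sup>2 * (w \<bullet> u)) + 1/2 * (d \<bullet> (A *v d))"
        unfolding du \<phi>_def by (simp add: matrix_vector_mult_scaleR power2_eq_square algebra_simps)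
      also have "1/2 * (r\<^sup>2 * (w \<bullet> u)) \<le> r * (w \<bullet> u)"
      proof -
        have "r\<^sup>2 * (w \<bullet> u) \<le> r * (w \<bullet> u)"
          using r wu by (intro mult_right_mono) (auto simp: power2_eq_square)
        moreover have "0 \<le> r * (w \<bullet> u)" using r wu by simp
        ultimately show ?thesis by linarith
      qed
      also have "r * (w \<bullet> u) = w \<bullet> d" unfolding du by simp
      finally show ?thesis using gap p(2) by (simp add: r_def d_def dist_norm)
    qed
  qed
  thus ?thesis using \<eta>(1) by (intro exI[of _ "\<eta>/2"]) auto
qed

text \<open>Near a solution \<open>s\<close> only the pieces containing \<open>s\<close> occur. On such a piece the minimal value of the
  objective is attained, so that the previous lemma applies; the minimum over the finitely many
  pieces is a constant valid for all solutions at once.\<close>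
lemma PLQ_quadratic_growth:
  fixes F :: "real^'n \<Rightarrow> ereal"
  assumes plq: "convex_PLQ F"
  defines "S \<equiv> {s. \<forall>y. F s \<le> F y}"
  shows "\<exists>c>0. \<forall>s\<in>S. \<forall>\<^sub>F x in nhds s. x \<in> edom F \<longrightarrow> c * (infdist x S)\<^sup>2 \<le> rval F x - rval F s"
proof -
  have F: "F \<in> Gamma0" using plq by (simp add: convex_PLQ_def)
  obtain P where P: "finite P" "edom F = \<Union>P" and poly: "\<And>C. C \<in> P \<Longrightarrow> polyhedron C"
    and quad: "\<And>C. C \<in> P \<Longrightarrow> \<exists>A b c. transpose A = A \<and> (\<forall>v. 0 \<le> v \<bullet> (A *v v)) \<and>
           (\<forall>x\<in>C. F x = ereal (1/2 * (x \<bullet> (A *v x)) + b \<bullet> x + c))"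
    using plq unfolding convex_PLQ_def by metis
  have min: "rval F s \<le> rval F x" if "s \<in> S" "x \<in> edom F" for s x
  proof -
    have "F s \<le> ereal (rval F x)" using that Gamma0_ereal[OF F that(2)] S_def by auto
    thus ?thesis by (simp add: Gamma0_le_iff[OF F])
  qed
  have S_dom: "S \<subseteq> edom F"
  proof
    fix s assume "s \<in> S"
    moreover obtain y where "y \<in> edom F" using F by (auto simp: Gamma0_def proper_fun_def)
    ultimately show "s \<in> edom F" by (auto simp: S_def edom_def intro: le_less_trans)
  qed
  have S_I: "x \<in> S" if "s \<in> S" "x \<in> edom F" "rval F x = rval F s" for x s
    using that S_dom Gamma0_ereal[OF F] unfolding S_def by (metis mem_Collect_eq subsetD)
  have "\<exists>\<eta>>0. \<forall>s\<in>S \<inter> C. \<forall>x\<in>C. dist x s \<le> 1 \<longrightarrow> \<eta> * (infdist x S)\<^sup>2 \<le> rval F x - rval F s"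
    if C: "C \<in> P" for C
  proof (cases "S \<inter> C = {}")
    case True
    thus ?thesis by (intro exI[of _ 1]) auto
  next
    case False
    then obtain s0 where s0: "s0 \<in> S" "s0 \<in> C" by blast
    have CF: "C \<subseteq> edom F" using P(2) C by blast
    obtain A b c where A: "transpose A = A" "\<And>v. 0 \<le> v \<bullet> (A *v v)"
      and Fx: "\<And>x. x \<in> C \<Longrightarrow> F x = ereal (1/2 * (x \<bullet> (A *v x)) + b \<bullet> x + c)"
      using quad[OF C] by blast
    define q where "q x = 1/2 * (x \<bullet> (A *v x)) + b \<bullet> x + c" for x
    have q: "rval F x = q x" if "x \<in> C" for x using Fx[OF that] by (simp add: q_def)
    define S' where "S' = {x\<in>C. q x = rval F s0}"
    have "S' \<subseteq> S" using S_I[OF s0(1)] q CF by (auto simp: S'_def)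
    have "s0 \<in> S'" using s0 q by (simp add: S'_def)
    obtain \<eta> where \<eta>: "\<eta> > 0" "\<And>x. x \<in> C \<Longrightarrow> infdist x S' \<le> 1 \<Longrightarrow> \<eta> * (infdist x S')\<^sup>2 \<le> q x - rval F s0"
    proof -
      have low: "rval F s0 \<le> 1/2 * (x \<bullet> (A *v x)) + b \<bullet> x + c" if "x \<in> C" for x
        using min[OF s0(1), of x] that q CF unfolding q_def by auto
      have ne: "{x \<in> C. 1/2 * (x \<bullet> (A *v x)) + b \<bullet> x + c = rval F s0} \<noteq> {}"
        using \<open>s0 \<in> S'\<close> unfolding S'_def q_def by blast
      show ?thesis
        using quadratic_growth_polyhedron[OF poly[OF C] A(1,2) low ne] that unfolding S'_def q_def by blast
    qed
    have "\<eta> * (infdist x S)\<^sup>2 \<le> rval F x - rval F s" if s: "s \<in> S \<inter> C" and x: "x \<in> C" "dist x s \<le> 1" for s x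
    proof -
      have ss: "rval F s = rval F s0" using min[OF s0(1), of s] min[of s s0] s s0 S_dom by force
      have "s \<in> S'" using s q ss by (auto simp: S'_def)
      have "infdist x S' \<le> 1" using infdist_le[OF \<open>s \<in> S'\<close>, of x] x by linarith
      moreover have "infdist x S \<le> infdist x S'"
        using \<open>S' \<subseteq> S\<close> \<open>s \<in> S'\<close> by (intro infdist_mono) auto
      hence "\<eta> * (infdist x S)\<^sup>2 \<le> \<eta> * (infdist x S')\<^sup>2"
        using \<eta>(1) infdist_nonneg by (intro mult_left_mono power_mono) auto
      ultimately show ?thesis using \<eta>(2)[OF x(1)] q[OF x(1)] ss by linarith
    qed
    thus ?thesis using \<eta>(1) by blast
  qed
  then obtain \<eta> where \<eta>: "\<And>C. C \<in> P \<Longrightarrow> \<eta> C > 0"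
    "\<And>C s x. \<lbrakk>C \<in> P; s \<in> S \<inter> C; x \<in> C; dist x s \<le> 1\<rbrakk> \<Longrightarrow> \<eta> C * (infdist x S)\<^sup>2 \<le> rval F x - rval F s"
    by metis
  define c where "c = Min (insert 1 (\<eta> ` P))"
  have c: "c > 0" "\<And>C. C \<in> P \<Longrightarrow> c \<le> \<eta> C"
    unfolding c_def using P(1) \<eta>(1) by auto
  have "\<forall>\<^sub>F x in nhds s. x \<in> edom F \<longrightarrow> c * (infdist x S)\<^sup>2 \<le> rval F x - rval F s" if s: "s \<in> S" for s
  proof -
    have "closed (\<Union>{C\<in>P. s \<notin> C})" using P(1) poly polyhedron_imp_closed by (intro closed_Union) auto
    hence "open (- (\<Union>{C\<in>P. s \<notin> C}))" by (rule open_Compl)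
    hence "\<forall>\<^sub>F x in nhds s. x \<in> - (\<Union>{C\<in>P. s \<notin> C})" by (intro eventually_nhds_in_open) auto
    moreover have "\<forall>\<^sub>F x in nhds s. x \<in> ball s 1" by (intro eventually_nhds_in_open) auto
    ultimately show ?thesis
    proof (eventually_elim, intro impI)
      case (elim x)
      assume "x \<in> edom F"
      then obtain C where C: "C \<in> P" "x \<in> C" using P(2) by auto
      hence "s \<in> C" using elim(1) by blast
      have "c * (infdist x S)\<^sup>2 \<le> \<eta> C * (infdist x S)\<^sup>2" using c(2)[OF C(1)] by (intro mult_right_mono) auto
      also have "\<dots> \<le> rval F x - rval F s"
        using \<eta>(2)[OF C(1) _ C(2), of s] s \<open>s \<in> C\<close> elim(2) by (simp add: dist_commute)
      finally show "c * (infdist x S)\<^sup>2 \<le> rval F x - rval F s" .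
    qed
  qed
  thus ?thesis using c(1) by blast
qed

section \<open>From quadratic growth to linear rates\<close>

lemma Gamma0_minimizers:
  fixes F :: "real^'n \<Rightarrow> ereal"
  assumes F: "F \<in> Gamma0" and s: "\<forall>y. F s \<le> F y"
  shows "s \<in> edom F" and "y \<in> edom F \<Longrightarrow> rval F s \<le> rval F y"
    and "{z. \<forall>y. F z \<le> F y} = {z \<in> edom F. rval F z \<le> rval F s}"
proof -
  obtain w where w: "w \<in> edom F" using F by (auto simp: Gamma0_def proper_fun_def)
  have dom: "z \<in> edom F" if "\<forall>y. F z \<le> F y" for z
    using that w by (auto simp: edom_def intro: le_less_trans)
  have le: "rval F z \<le> rval F y" if "\<forall>y. F z \<le> F y" "y \<in> edom F" for y z
  proof -
    have "F z \<le> ereal (rval F y)" using that Gamma0_ereal[OF F that(2)] by metis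
    thus ?thesis by (simp add: Gamma0_le_iff[OF F])
  qed
  show "s \<in> edom F" and "y \<in> edom F \<Longrightarrow> rval F s \<le> rval F y" using s dom le by auto
  have "F z \<le> F y" if "z \<in> edom F" "rval F z \<le> rval F s" for y z
  proof -
    have "F z \<le> ereal (rval F s)" using that by (simp add: Gamma0_le_iff[OF F])
    also have "\<dots> = F s" using Gamma0_ereal[OF F dom[OF s]] by simp
    also have "\<dots> \<le> F y" using s by simp
    finally show ?thesis .
  qed
  thus "{z. \<forall>y. F z \<le> F y} = {z \<in> edom F. rval F z \<le> rval F s}"
    using dom le[OF _ dom[OF s]] by blast
qed

lemma Gamma0_closed_sublevel:
  fixes F :: "real^'n \<Rightarrow> ereal"
  assumes F: "F \<in> Gamma0"
  shows "closed {z \<in> edom F. rval F z \<le> t}"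
  unfolding closed_sequential_limits
proof (intro allI impI, elim conjE)
  fix X l assume X: "\<forall>n. X n \<in> {z \<in> edom F. rval F z \<le> t}" "X \<longlonglongrightarrow> l"
  show "l \<in> {z \<in> edom F. rval F z \<le> t}"
    using Gamma0_lower_limit[OF F X(2), of "\<lambda>_. t" t] X(1) by auto
qed

text \<open>By the three-point inequality the distance to every solution is nonincreasing, and the values tend
  to the minimum, so the iterates converge to some solution \<open>s\<close>.

  Quadratic growth controls only the distance to the solution set, whereas the claim is about the
  distance to \<open>s\<close>. The two are comparable: no later iterate is farther from the projection \<open>p\<close> of \<open>x\<^sub>k\<close>
  than \<open>x\<^sub>k\<close> is, hence neither is \<open>s\<close>, and \<open>\<parallel>x\<^sub>k - s\<parallel> \<le> 2 dist(x\<^sub>k, S)\<close>. Inserting the growth estimate into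
  the three-point inequality at \<open>y = s\<close> contracts \<open>\<parallel>x\<^sub>k - s\<parallel>\<^sup>2\<close> by the factor \<open>1 / (1 + a c / 2)\<close>.

  For the values, the three-point inequality is taken at \<open>y = (1 - \<mu>) x\<^sub>k + \<mu> p\<close>: the excess over the
  minimum becomes at most \<open>1 - \<mu> + \<mu>\<^sup>2 / (2 a c)\<close> times the previous one, and \<open>\<mu> = min 1 (a c)\<close> makes
  this at most \<open>1 - \<mu> / 2\<close>.\<close>
lemma fejer_growth_rates:
  fixes F :: "real^'n \<Rightarrow> ereal" and x :: "nat \<Rightarrow> real^'n" and \<alpha> :: "nat \<Rightarrow> real"
  defines "S \<equiv> {s. \<forall>y. F s \<le> F y}"
  assumes F: "F \<in> Gamma0" and ne: "S \<noteq> {}" and a: "a > 0" "\<And>k. a \<le> \<alpha> k" and c: "c > 0"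
    and dom: "\<And>k. x k \<in> edom F"
    and three: "\<And>k y. y \<in> edom F \<Longrightarrow>
      (norm (x (Suc k) - y))\<^sup>2 \<le> (norm (x k - y))\<^sup>2 + 2 * \<alpha> k * (rval F y - rval F (x (Suc k)))"
    and growth: "\<forall>s\<in>S. \<forall>\<^sub>F z in nhds s. z \<in> edom F \<longrightarrow> c * (infdist z S)\<^sup>2 \<le> rval F z - rval F s"
  shows "\<exists>s\<in>S. x \<longlonglongrightarrow> s \<and> q_linear x s (sqrt (1 / (1 + a * c / 2))) \<and>
     (\<lambda>k. rval F (x k)) \<longlonglongrightarrow> rval F s \<and> q_linear (\<lambda>k. rval F (x k)) (rval F s) (1 - min 1 (a * c) / 2)"
proof -
  obtain s0 where s0: "s0 \<in> S" using ne by blast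
  define m where "m = rval F s0"
  have S_eq: "S = {z \<in> edom F. rval F z \<le> m}"
    using Gamma0_minimizers(3)[OF F, of s0] s0 unfolding S_def m_def by blast
  have low: "m \<le> rval F y" if "y \<in> edom F" for y
    using Gamma0_minimizers(2)[OF F, of s0] s0 that unfolding S_def m_def by blast
  have Sm: "s \<in> edom F \<and> rval F s = m" if "s \<in> S" for s
    using that low[of s] unfolding S_eq by auto
  have closS: "closed S" unfolding S_eq by (rule Gamma0_closed_sublevel[OF F])
  define \<delta> where "\<delta> k = rval F (x k) - m" for k
  have \<delta>: "0 \<le> \<delta> k" for k using low[OF dom] by (simp add: \<delta>_def)
  have \<alpha>: "0 < \<alpha> k" for k using a by (meson less_le_trans)
  have dec: "\<delta> (Suc k) \<le> \<delta> k" for k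
  proof -
    have "0 \<le> (norm (x (Suc k) - x k))\<^sup>2" by simp
    also have "\<dots> \<le> 2 * \<alpha> k * (\<delta> k - \<delta> (Suc k))"
      using three[OF dom, of k k] by (simp add: \<delta>_def)
    finally have "0 \<le> 2 * \<alpha> k * (\<delta> k - \<delta> (Suc k))" .
    thus ?thesis using \<alpha>[of k] by (simp add: zero_le_mult_iff)
  qed
  have fejer: "(norm (x (Suc k) - s))\<^sup>2 + 2 * a * \<delta> (Suc k) \<le> (norm (x k - s))\<^sup>2" if "s \<in> S" for s k
  proof -
    have "(norm (x (Suc k) - s))\<^sup>2 \<le> (norm (x k - s))\<^sup>2 - 2 * \<alpha> k * \<delta> (Suc k)"
      using three[of s k] Sm[OF that] by (simp add: \<delta>_def algebra_simps)
    moreover have "2 * a * \<delta> (Suc k) \<le> 2 * \<alpha> k * \<delta> (Suc k)"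
      using a \<delta> by (intro mult_right_mono) auto
    ultimately show ?thesis by linarith
  qed
  have step: "norm (x (Suc k) - s) \<le> norm (x k - s)" if "s \<in> S" for s k
  proof (rule power2_le_imp_le)
    have "0 \<le> 2 * a * \<delta> (Suc k)" using a \<delta> by simp
    thus "(norm (x (Suc k) - s))\<^sup>2 \<le> (norm (x k - s))\<^sup>2" using fejer[OF that, of k] by linarith
  qed simp
  have mono: "norm (x j - s) \<le> norm (x k - s)" if "s \<in> S" "k \<le> j" for s j k
    using lift_Suc_antimono_le[of "\<lambda>k. norm (x k - s)" k j] step that by blast

  have sublinear: "(norm (x N - s0))\<^sup>2 + 2 * a * (real N * \<delta> N) \<le> (norm (x 0 - s0))\<^sup>2" for N
  proof (induction N)
    case (Suc N)
    have "real N * \<delta> (Suc N) \<le> real N * \<delta> N" using dec by (intro mult_left_mono) auto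
    hence "2 * a * (real N * \<delta> (Suc N)) \<le> 2 * a * (real N * \<delta> N)" by (rule mult_left_mono) (use a in simp)
    moreover have "2 * a * (real (Suc N) * \<delta> (Suc N)) = 2 * a * (real N * \<delta> (Suc N)) + 2 * a * \<delta> (Suc N)"
      by (simp add: algebra_simps)
    ultimately show ?case using fejer[OF s0, of N] Suc.IH by linarith
  qed simp
  have \<delta>_lim: "\<delta> \<longlonglongrightarrow> 0"
  proof (rule tendsto_sandwich[OF _ _ tendsto_const])
    define B where "B = (norm (x 0 - s0))\<^sup>2 / (2 * a)"
    show "\<forall>\<^sub>F k in sequentially. 0 \<le> \<delta> k" using \<delta> by (intro always_eventually allI)
    have bound: "\<delta> k \<le> B * inverse (real k)" if "0 < k" for k
    proof -
      have "2 * a * (real k * \<delta> k) \<le> (norm (x 0 - s0))\<^sup>2"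
        using sublinear[of k] zero_le_power2[of "norm (x k - s0)"] by linarith
      thus ?thesis using that a(1) by (simp add: B_def field_simps)
    qed
    show "\<forall>\<^sub>F k in sequentially. \<delta> k \<le> B * inverse (real k)"
      using eventually_gt_at_top[of "0::nat"] by eventually_elim (rule bound)
    have "(\<lambda>k. B * inverse (real k)) \<longlonglongrightarrow> B * 0" by (intro tendsto_intros lim_inverse_n)
    thus "(\<lambda>k. B * inverse (real k)) \<longlonglongrightarrow> 0" by simp
  qed
  hence val_lim: "(\<lambda>k. rval F (x k)) \<longlonglongrightarrow> m"
    using tendsto_add[OF \<delta>_lim tendsto_const[of m]] by (simp add: \<delta>_def)

  have "x k \<in> cball s0 (norm (x 0 - s0))" for k
    using mono[OF s0, of 0 k] by (simp add: dist_norm norm_minus_commute)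
  then obtain s r where r: "strict_mono r" and sub: "(x \<circ> r) \<longlonglongrightarrow> s"
    using compact_cball[of s0 "norm (x 0 - s0)"] unfolding compact_def by blast
  have "(\<lambda>n. rval F (x (r n))) \<longlonglongrightarrow> m"
    using LIMSEQ_subseq_LIMSEQ[OF val_lim r] by (simp add: comp_def)
  from Gamma0_lower_limit[OF F sub this] have s: "s \<in> S" using dom unfolding S_eq by simp
  have x_lim: "x \<longlonglongrightarrow> s"
  proof (rule metric_LIMSEQ_I)
    fix \<epsilon> :: real assume "\<epsilon> > 0"
    then obtain n where "dist (x (r n)) s < \<epsilon>" using metric_LIMSEQ_D[OF sub] by force
    hence "\<forall>k\<ge>r n. dist (x k) s < \<epsilon>" using mono[OF s] unfolding dist_norm by (meson le_less_trans)
    thus "\<exists>N. \<forall>k\<ge>N. dist (x k) s < \<epsilon>" by blast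
  qed

  have "\<forall>\<^sub>F z in nhds s. z \<in> edom F \<longrightarrow> c * (infdist z S)\<^sup>2 \<le> rval F z - rval F s"
    using growth s by blast
  from eventually_compose_filterlim[OF this x_lim]
  have "\<forall>\<^sub>F k in sequentially. x k \<in> edom F \<longrightarrow> c * (infdist (x k) S)\<^sup>2 \<le> rval F (x k) - rval F s" .
  then obtain K where K: "\<And>k. K \<le> k \<Longrightarrow> c * (infdist (x k) S)\<^sup>2 \<le> \<delta> k"
    using dom Sm[OF s] unfolding eventually_sequentially \<delta>_def by auto
  have near: "norm (x k - s) \<le> 2 * infdist (x k) S" for k
  proof -
    obtain p where p: "p \<in> S" "infdist (x k) S = dist (x k) p" using infdist_attains_inf[OF closS ne] by blast
    have "norm (s - p) \<le> norm (x k - p)"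
    proof (rule tendsto_upperbound)
      show "(\<lambda>j. norm (x j - p)) \<longlonglongrightarrow> norm (s - p)" by (intro tendsto_intros x_lim)
      show "\<forall>\<^sub>F j in sequentially. norm (x j - p) \<le> norm (x k - p)"
        using eventually_ge_at_top[of k] by eventually_elim (rule mono[OF p(1)])
    qed simp
    moreover have "norm (x k - s) \<le> norm (x k - p) + norm (s - p)"
      using norm_triangle_ineq4[of "x k - p" "s - p"] by simp
    ultimately show ?thesis using p(2) by (simp add: dist_norm)
  qed

  have ql_x: "q_linear x s (sqrt (1 / (1 + a * c / 2)))"
    unfolding q_linear_def
  proof (intro conjI exI[of _ K] allI impI)
    let ?D = "1 + a * c / 2"
    have D: "?D > 1" using a c by simp
    show "0 < sqrt (1 / ?D)" "sqrt (1 / ?D) < 1" using D by auto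
    fix k assume k: "K \<le> k"
    let ?u = "norm (x (Suc k) - s)"
    have "(?u / 2)\<^sup>2 \<le> (infdist (x (Suc k)) S)\<^sup>2" using near[of "Suc k"] by (intro power_mono) auto
    hence "c * (?u / 2)\<^sup>2 \<le> \<delta> (Suc k)" using K[of "Suc k"] k c by (meson le_SucI mult_left_mono less_imp_le order_trans)
    hence "2 * a * (c * (?u / 2)\<^sup>2) \<le> 2 * a * \<delta> (Suc k)" using a by (intro mult_left_mono) auto
    hence "?D * ?u\<^sup>2 \<le> (norm (x k - s))\<^sup>2"
      using fejer[OF s, of k] by (simp add: power_divide algebra_simps)
    hence "?u\<^sup>2 \<le> 1 / ?D * (norm (x k - s))\<^sup>2" using D by (simp add: field_simps)
    hence "sqrt (?u\<^sup>2) \<le> sqrt (1 / ?D * (norm (x k - s))\<^sup>2)" by (rule real_sqrt_le_mono)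
    thus "?u \<le> sqrt (1 / ?D) * norm (x k - s)" unfolding real_sqrt_mult by simp
  qed

  have ql_F: "q_linear (\<lambda>k. rval F (x k)) m (1 - min 1 (a * c) / 2)"
    unfolding q_linear_def
  proof (intro conjI exI[of _ K] allI impI)
    define \<mu> where "\<mu> = min 1 (a * c)"
    have \<mu>: "0 < \<mu>" "\<mu> \<le> 1" "\<mu> \<le> a * c" using a c by (auto simp: \<mu>_def)
    show "0 < 1 - min 1 (a * c) / 2" "1 - min 1 (a * c) / 2 < 1" using \<mu> unfolding \<mu>_def by linarith+
    fix k assume k: "K \<le> k"
    obtain p where p: "p \<in> S" "infdist (x k) S = dist (x k) p" using infdist_attains_inf[OF closS ne] by blast
    define y where "y = (1 - \<mu>) *\<^sub>R x k + \<mu> *\<^sub>R p"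
    have y: "y \<in> edom F" "rval F y \<le> (1 - \<mu>) * rval F (x k) + \<mu> * m"
      using Gamma0_convexD[OF F dom, of p \<mu> k] Sm[OF p(1)] \<mu> unfolding y_def by auto
    have "x k - y = \<mu> *\<^sub>R (x k - p)" by (simp add: y_def algebra_simps)
    hence dist: "(norm (x k - y))\<^sup>2 = \<mu>\<^sup>2 * (infdist (x k) S)\<^sup>2"
      using p(2) \<mu> by (simp add: dist_norm power_mult_distrib)
    have gap: "rval F y - rval F (x (Suc k)) \<le> (1 - \<mu>) * \<delta> k - \<delta> (Suc k)"
      using y(2) by (simp add: \<delta>_def algebra_simps)
    have "\<delta> (Suc k) \<le> (1 - \<mu> / 2) * \<delta> k"
    proof (rule ccontr)
      assume "\<not> ?thesis"
      hence less: "\<mu> / 2 * \<delta> k < \<delta> (Suc k) - (1 - \<mu>) * \<delta> k" by (simp add: algebra_simps)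
      have "0 \<le> \<mu> / 2 * \<delta> k" using \<mu> \<delta> by simp
      with less have pos: "0 \<le> \<delta> (Suc k) - (1 - \<mu>) * \<delta> k" by linarith
      have "2 * \<alpha> k * (rval F y - rval F (x (Suc k))) \<le> 2 * \<alpha> k * ((1 - \<mu>) * \<delta> k - \<delta> (Suc k))"
        using gap \<alpha>[of k] by (intro mult_left_mono) auto
      hence "2 * \<alpha> k * (\<delta> (Suc k) - (1 - \<mu>) * \<delta> k) \<le> (norm (x k - y))\<^sup>2"
        using three[OF y(1), of k] zero_le_power2[of "norm (x (Suc k) - y)"]
        unfolding right_diff_distrib by linarith
      moreover have "2 * a * (\<delta> (Suc k) - (1 - \<mu>) * \<delta> k) \<le> 2 * \<alpha> k * (\<delta> (Suc k) - (1 - \<mu>) * \<delta> k)"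
        using a(2) pos by (intro mult_right_mono) auto
      moreover have "2 * a * (\<mu> / 2 * \<delta> k) < 2 * a * (\<delta> (Suc k) - (1 - \<mu>) * \<delta> k)"
        using less a(1) by (intro mult_strict_left_mono) auto
      ultimately have "2 * a * (\<mu> / 2 * \<delta> k) < (norm (x k - y))\<^sup>2" by linarith
      hence "a * (\<mu> * \<delta> k) < \<mu>\<^sup>2 * (infdist (x k) S)\<^sup>2" unfolding dist by simp
      hence "a * \<delta> k < \<mu> * (infdist (x k) S)\<^sup>2" using \<mu>(1) by (simp add: power2_eq_square)
      also have "\<dots> \<le> (a * c) * (infdist (x k) S)\<^sup>2" using \<mu>(3) by (intro mult_right_mono) auto
      also have "\<dots> \<le> a * \<delta> k" using K[OF k] a(1) by simp
      finally show False by simp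
    qed
    thus "norm (rval F (x (Suc k)) - m) \<le> (1 - min 1 (a * c) / 2) * norm (rval F (x k) - m)"
      using \<delta>[of k] \<delta>[of "Suc k"] unfolding \<delta>_def \<mu>_def real_norm_def by (simp only: abs_of_nonneg)
  qed
  show ?thesis using s x_lim ql_x val_lim ql_F Sm[OF s] by auto
qed

section \<open>The iterates of the method\<close>

text \<open>The bound on the step sizes is inherited along the sequence because each line search starts from the
  previous step size: the result is at least \<open>min \<alpha>\<^sub>k\<^sub>-\<^sub>1 (\<theta> * c)\<close>.\<close>
lemma fbs_invariant:
  fixes f g :: "real^'n \<Rightarrow> ereal" and c :: real
  assumes seq: "fbs_sequences f g \<sigma> \<theta> x \<alpha>" and \<sigma>: "\<sigma> > 0" and \<theta>: "0 < \<theta>" "\<theta> < 1" and c: "c > 0"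
    and x0: "x 0 \<in> K"
    and acc: "\<And>z \<beta>. z \<in> K \<Longrightarrow> 0 < \<beta> \<Longrightarrow> \<beta> \<le> c \<Longrightarrow> sufficient_decrease f g z \<beta>"
    and inv: "\<And>z \<beta>. z \<in> K \<Longrightarrow> 0 < \<beta> \<Longrightarrow> sufficient_decrease f g z \<beta> \<Longrightarrow> fb_step f g z \<beta> \<in> K"
  shows "x k \<in> K \<and> sufficient_decrease f g (x k) (\<alpha> k) \<and> min \<sigma> (\<theta> * c) \<le> \<alpha> k"
proof (induction k)
  case 0
  have "\<alpha> 0 = line_search f g (x 0) \<sigma> \<theta>" using seq by (simp add: fbs_sequences_def)
  thus ?case using line_search_bounds[OF \<theta> c \<sigma> acc[OF x0]] x0 by simp
next
  case (Suc k)
  have "0 < min \<sigma> (\<theta> * c)" using \<sigma> \<theta> c by simp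
  hence \<alpha>: "0 < \<alpha> k" using Suc by linarith
  have "x (Suc k) = fb_step f g (x k) (\<alpha> k)" using seq by (simp add: fbs_sequences_def)
  hence xK: "x (Suc k) \<in> K" using inv Suc \<alpha> by simp
  have "\<alpha> (Suc k) = line_search f g (x (Suc k)) (\<alpha> k) \<theta>" using seq by (simp add: fbs_sequences_def)
  hence "sufficient_decrease f g (x (Suc k)) (\<alpha> (Suc k))" "min (\<alpha> k) (\<theta> * c) \<le> \<alpha> (Suc k)"
    using line_search_bounds[OF \<theta> c \<alpha> acc[OF xK]] by simp_all
  thus ?case using xK Suc by (auto simp: min_def split: if_splits)
qed

lemma fbs_converges_with_rates:
  fixes f g :: "real^'n \<Rightarrow> ereal"
  assumes A1: "assumption_A1 f g" and A2: "assumption_A2 f g"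
    and F: "objective f g \<in> Gamma0" and ne: "solutions f g \<noteq> {}"
    and seq: "fbs_sequences f g \<sigma> \<theta> x \<alpha>"
    and adm: "\<And>k. x k \<in> admissible f g" and dec: "\<And>k. sufficient_decrease f g (x k) (\<alpha> k)"
    and a: "a > 0" "\<And>k. a \<le> \<alpha> k" and c: "c > 0"
    and growth: "\<forall>s\<in>solutions f g. \<forall>\<^sub>F z in nhds s. z \<in> edom (objective f g) \<longrightarrow>
        c * (infdist z (solutions f g))\<^sup>2 \<le> rval (objective f g) z - rval (objective f g) s"
  shows "converges_with_rates f g x (sqrt (1 / (1 + a * c / 2))) (1 - min 1 (a * c) / 2)"
proof -
  let ?F = "objective f g"
  have f: "f \<in> Gamma0" and g: "g \<in> Gamma0" using A1 by (auto simp: assumption_A1_def)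
  have S: "solutions f g = {s. \<forall>y. ?F s \<le> ?F y}" by (simp add: solutions_def)
  have \<alpha>: "0 < \<alpha> k" for k using a by (meson less_le_trans)
  have cd: "cont_diff_at f (x k)" for k using A2 adm[of k] unfolding assumption_A2_def by blast
  have dom: "x k \<in> edom ?F" for k
    using adm[of k] interior_subset by (auto simp: edom_objective(1)[OF f g] admissible_def)
  have next_x: "x (Suc k) = fb_step f g (x k) (\<alpha> k)" for k using seq by (simp add: fbs_sequences_def)
  have "\<exists>s\<in>solutions f g. x \<longlonglongrightarrow> s \<and> q_linear x s (sqrt (1 / (1 + a * c / 2))) \<and>
     (\<lambda>k. rval ?F (x k)) \<longlonglongrightarrow> rval ?F s \<and> q_linear (\<lambda>k. rval ?F (x k)) (rval ?F s) (1 - min 1 (a * c) / 2)"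
    unfolding S
  proof (rule fejer_growth_rates[OF F _ a c dom])
    show "(norm (x (Suc k) - y))\<^sup>2 \<le> (norm (x k - y))\<^sup>2 + 2 * \<alpha> k * (rval ?F y - rval ?F (x (Suc k)))"
      if "y \<in> edom ?F" for k y
      using three_point_inequality(2)[OF f g \<alpha> cd dec that] unfolding next_x .
  qed (use ne growth in \<open>simp_all add: S\<close>)
  then obtain s where s: "s \<in> solutions f g" "x \<longlonglongrightarrow> s" "q_linear x s (sqrt (1 / (1 + a * c / 2)))"
    "(\<lambda>k. rval ?F (x k)) \<longlonglongrightarrow> rval ?F s" "q_linear (\<lambda>k. rval ?F (x k)) (rval ?F s) (1 - min 1 (a * c) / 2)"
    by blast
  have sF: "?F s = ereal (rval ?F s)"
    using Gamma0_ereal[OF F Gamma0_minimizers(1)[OF F]] s(1) unfolding S by blast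
  have opt: "optimal_value f g = ereal (rval ?F s)"
  proof -
    have "optimal_value f g = ?F s"
      unfolding optimal_value_def using s(1) by (intro antisym INF_lower INF_greatest) (auto simp: solutions_def)
    thus ?thesis using sF by simp
  qed
  have "(\<lambda>k. ?F (x k)) = (\<lambda>k. ereal (rval ?F (x k)))" using Gamma0_ereal[OF F dom] by blast
  moreover have "(\<lambda>k. ereal (rval ?F (x k))) \<longlonglongrightarrow> ereal (rval ?F s)" using s(4) by simp
  ultimately have "(\<lambda>k. ?F (x k)) \<longlonglongrightarrow> optimal_value f g" using opt by simp
  thus ?thesis unfolding converges_with_rates_def opt using s by auto
qed

lemma fb_step_admissible:
  fixes f g :: "real^'n \<Rightarrow> ereal"
  assumes A1: "assumption_A1 f g" and A2: "assumption_A2 f g" and F: "objective f g \<in> Gamma0"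
    and x: "x \<in> admissible f g" and \<alpha>: "\<alpha> > 0" and dec: "sufficient_decrease f g x \<alpha>"
  shows "objective f g (fb_step f g x \<alpha>) \<le> objective f g x" "fb_step f g x \<alpha> \<in> admissible f g"
proof -
  let ?F = "objective f g" and ?p = "fb_step f g x \<alpha>"
  have f: "f \<in> Gamma0" and g: "g \<in> Gamma0" using A1 by (auto simp: assumption_A1_def)
  have cd: "cont_diff_at f x" using A2 x unfolding assumption_A2_def by blast
  have dom: "x \<in> edom ?F" using x interior_subset by (auto simp: edom_objective(1)[OF f g] admissible_def)
  note three = three_point_inequality[OF f g \<alpha> cd dec]
  have "0 \<le> (norm (?p - x))\<^sup>2" by simp
  also have "\<dots> \<le> 2 * \<alpha> * (rval ?F x - rval ?F ?p)" using three(2)[OF dom] by simp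
  finally have "rval ?F ?p \<le> rval ?F x" using \<alpha> by (simp add: zero_le_mult_iff)
  thus le: "?F ?p \<le> ?F x" using Gamma0_ereal[OF F three(1)] Gamma0_ereal[OF F dom] by (metis ereal_less_eq(3))
  show "?p \<in> admissible f g" using le A2 x unfolding assumption_A2_def by blast
qed

text \<open>The iterates remain in the set of points that have at most the initial objective value and at most
  the initial distance from a fixed solution. It is compact, and by (A2) contained in the interior of
  \<open>dom f\<close>, so one threshold for accepted steps serves all iterates. The threshold depends on the
  starting point through this set.\<close>
lemma fbs_stepsizes_bounded_below:
  fixes f g :: "real^'n \<Rightarrow> ereal"
  assumes A1: "assumption_A1 f g" and A2: "assumption_A2 f g"
    and \<sigma>: "\<sigma> > 0" and \<theta>: "0 < \<theta>" "\<theta> < 1"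
    and F: "objective f g \<in> Gamma0" and ne: "solutions f g \<noteq> {}"
    and loc_lip: "\<forall>s\<in>solutions f g. \<exists>r>0. \<exists>L. L-lipschitz_on (ball s r) (grad f)"
    and seq: "fbs_sequences f g \<sigma> \<theta> x \<alpha>"
  shows "\<exists>a>0. \<forall>k. x k \<in> admissible f g \<and> sufficient_decrease f g (x k) (\<alpha> k) \<and> a \<le> \<alpha> k"
proof -
  let ?F = "objective f g"
  have f: "f \<in> Gamma0" and g: "g \<in> Gamma0" using A1 by (auto simp: assumption_A1_def)
  note dom = edom_objective(1)[OF f g]
  have cd: "cont_diff_at f y" if "y \<in> admissible f g" for y using A2 that unfolding assumption_A2_def by blast
  have adm_dom: "y \<in> edom ?F" if "y \<in> admissible f g" for y
    using that interior_subset by (auto simp: dom admissible_def)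
  obtain s where s: "s \<in> solutions f g" using ne by blast
  have s_min: "\<forall>y. ?F s \<le> ?F y" using s by (simp add: solutions_def)
  note sF = Gamma0_minimizers(1)[OF F s_min] and low = Gamma0_minimizers(2)[OF F s_min]
  have x0: "x 0 \<in> admissible f g" using seq by (simp add: fbs_sequences_def)
  define K where "K = {z \<in> edom ?F. rval ?F z \<le> rval ?F (x 0)} \<inter> cball s (norm (x 0 - s))"
  have "compact K"
    unfolding K_def using Gamma0_closed_sublevel[OF F] by (intro closed_Int_compact compact_cball)
  have K_le: "?F z \<le> ?F (x 0)" if "z \<in> K" for z
  proof -
    have "?F z \<le> ereal (rval ?F (x 0))" using that by (simp add: K_def Gamma0_le_iff[OF F])
    thus ?thesis by (simp only: Gamma0_ereal[OF F adm_dom[OF x0], symmetric])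
  qed
  have K_adm: "K \<subseteq> admissible f g" using K_le A2 x0 unfolding assumption_A2_def by blast
  have x0K: "x 0 \<in> K" using adm_dom[OF x0] by (simp add: K_def dist_norm norm_minus_commute)
  have "\<exists>c>0. \<forall>z\<in>K. \<forall>\<beta>. 0 < \<beta> \<and> \<beta> \<le> c \<longrightarrow> sufficient_decrease f g z \<beta>"
    by (rule sufficient_decrease_compact[OF A1 A2 loc_lip \<open>compact K\<close> K_adm, of "rval ?F (x 0)"]) (simp add: K_def)
  then obtain c where c: "c > 0" "\<And>z \<beta>. z \<in> K \<Longrightarrow> 0 < \<beta> \<Longrightarrow> \<beta> \<le> c \<Longrightarrow> sufficient_decrease f g z \<beta>"
    by blast
  have inv: "fb_step f g z \<beta> \<in> K" if z: "z \<in> K" and \<beta>: "0 < \<beta>" and dec: "sufficient_decrease f g z \<beta>" for z \<beta>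
  proof -
    let ?p = "fb_step f g z \<beta>"
    have za: "z \<in> admissible f g" using z K_adm by blast
    have pF: "?p \<in> edom ?F" using three_point_inequality(1)[OF f g \<beta> cd[OF za] dec] .
    have "(norm (?p - s))\<^sup>2 \<le> (norm (z - s))\<^sup>2 + 2 * \<beta> * (rval ?F s - rval ?F ?p)"
      using three_point_inequality(2)[OF f g \<beta> cd[OF za] dec sF] .
    moreover have "2 * \<beta> * (rval ?F s - rval ?F ?p) \<le> 0" using low[OF pF] \<beta> by (intro mult_nonneg_nonpos) auto
    ultimately have "(norm (?p - s))\<^sup>2 \<le> (norm (z - s))\<^sup>2" by linarith
    hence "norm (?p - s) \<le> norm (z - s)" by (rule power2_le_imp_le) simp
    moreover have "norm (z - s) \<le> norm (x 0 - s)" using z by (simp add: K_def dist_norm norm_minus_commute)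
    moreover have "?F ?p \<le> ?F (x 0)" using fb_step_admissible(1)[OF A1 A2 F za \<beta> dec] K_le[OF z] by simp
    hence "?F ?p \<le> ereal (rval ?F (x 0))" by (simp only: Gamma0_ereal[OF F adm_dom[OF x0], symmetric])
    hence "rval ?F ?p \<le> rval ?F (x 0)" by (simp add: Gamma0_le_iff[OF F])
    ultimately show ?thesis using pF by (simp add: K_def dist_norm norm_minus_commute)
  qed
  have "min \<sigma> (\<theta> * c) > 0" using \<sigma> \<theta> c by simp
  moreover have "x k \<in> K \<and> sufficient_decrease f g (x k) (\<alpha> k) \<and> min \<sigma> (\<theta> * c) \<le> \<alpha> k" for k
    by (rule fbs_invariant[OF seq \<sigma> \<theta> c(1) x0K c(2) inv])
  ultimately show ?thesis using K_adm by blast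
qed

text \<open>Here the admissible set itself is invariant and the threshold \<open>1 / (2 L)\<close> holds on all of it, which
  removes the dependence on the starting point.\<close>
lemma fbs_stepsizes_uniformly_bounded_below:
  fixes f g :: "real^'n \<Rightarrow> ereal"
  assumes A1: "assumption_A1 f g" and A2: "assumption_A2 f g"
    and \<sigma>: "\<sigma> > 0" and \<theta>: "0 < \<theta>" "\<theta> < 1" and F: "objective f g \<in> Gamma0"
    and lip: "L-lipschitz_on (admissible f g) (grad f)" and L: "L > 0"
    and seq: "fbs_sequences f g \<sigma> \<theta> x \<alpha>"
  shows "x k \<in> admissible f g \<and> sufficient_decrease f g (x k) (\<alpha> k) \<and> min \<sigma> (\<theta> * (1 / (2 * L))) \<le> \<alpha> k"
proof (rule fbs_invariant[OF seq \<sigma> \<theta>])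
  show "0 < 1 / (2 * L)" using L by simp
  show "x 0 \<in> admissible f g" using seq by (simp add: fbs_sequences_def)
qed (use sufficient_decrease_global_Lipschitz[OF A1 A2 F lip L] fb_step_admissible(2)[OF A1 A2 F] in auto)

theorem corollary4p4:
  fixes f g :: "real^'n \<Rightarrow> ereal" and \<sigma> \<theta> :: real
  assumes A1: "assumption_A1 f g"
    and A2: "assumption_A2 f g"
    and \<sigma>: "\<sigma> > 0"
    and \<theta>: "0 < \<theta>" "\<theta> < 1"
    and PLQ: "convex_PLQ (objective f g)"
    and sol: "solutions f g \<noteq> {}"
    and loc_lip: "\<forall>s\<in>solutions f g. \<exists>r>0. \<exists>L. L-lipschitz_on (ball s r) (grad f)"
  shows "(\<forall>x \<alpha>. fbs_sequences f g \<sigma> \<theta> x \<alpha> \<longrightarrow>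
            (\<exists>\<rho> \<rho>'. converges_with_rates f g x \<rho> \<rho>'))
       \<and> ((\<exists>L. L-lipschitz_on (admissible f g) (grad f)) \<longrightarrow>
            (\<exists>\<rho> \<rho>'. \<forall>x \<alpha>. fbs_sequences f g \<sigma> \<theta> x \<alpha> \<longrightarrow> converges_with_rates f g x \<rho> \<rho>'))"
proof (intro conjI allI impI)
  let ?F = "objective f g"
  have F: "?F \<in> Gamma0" using PLQ by (simp add: convex_PLQ_def)
  obtain c where c: "c > 0" and growth: "\<forall>s\<in>solutions f g. \<forall>\<^sub>F z in nhds s. z \<in> edom ?F \<longrightarrow>
      c * (infdist z (solutions f g))\<^sup>2 \<le> rval ?F z - rval ?F s"
    using PLQ_quadratic_growth[OF PLQ] unfolding solutions_def by blast
  note rates = fbs_converges_with_rates[OF A1 A2 F sol _ _ _ _ _ c growth]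
  {
    fix x \<alpha> assume seq: "fbs_sequences f g \<sigma> \<theta> x \<alpha>"
    obtain a where "a > 0" "\<And>k. x k \<in> admissible f g" "\<And>k. sufficient_decrease f g (x k) (\<alpha> k)" "\<And>k. a \<le> \<alpha> k"
      using fbs_stepsizes_bounded_below[OF A1 A2 \<sigma> \<theta> F sol loc_lip seq] by blast
    thus "\<exists>\<rho> \<rho>'. converges_with_rates f g x \<rho> \<rho>'" using rates[OF seq] by blast
  }
  {
    assume "\<exists>L. L-lipschitz_on (admissible f g) (grad f)"
    then obtain L where lip: "L-lipschitz_on (admissible f g) (grad f)" by blast
    hence L: "L + 1 > 0" and lip': "(L + 1)-lipschitz_on (admissible f g) (grad f)"
      using lipschitz_on_nonneg[OF lip] by (auto intro: lipschitz_on_mono)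
    define a where "a = min \<sigma> (\<theta> * (1 / (2 * (L + 1))))"
    have a: "a > 0" using \<sigma> \<theta> L by (simp add: a_def)
    note uniform = fbs_stepsizes_uniformly_bounded_below[OF A1 A2 \<sigma> \<theta> F lip' L, folded a_def]
    have "converges_with_rates f g x (sqrt (1 / (1 + a * c / 2))) (1 - min 1 (a * c) / 2)"
      if "fbs_sequences f g \<sigma> \<theta> x \<alpha>" for x \<alpha>
      using rates[OF that _ _ a] uniform[OF that] by blast
    thus "\<exists>\<rho> \<rho>'. \<forall>x \<alpha>. fbs_sequences f g \<sigma> \<theta> x \<alpha> \<longrightarrow> converges_with_rates f g x \<rho> \<rho>'" by blast
  }
qed

end
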